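(* Let $G$ be a second-countable locally compact group and let $(A,\alpha)$ and $(B,\beta)$ be two separable $G$-C*-algebras. Suppose that $(\phi,\mathsf u):(A,\alpha)\to(B,\beta)$ and $(\psi,\mathsf v):(B,\beta)\to(A,\alpha)$ are two non-degenerate cocycle morphisms such that the compositions $(\psi,\mathsf v)\circ(\phi,\mathsf u)$ and $(\phi,\mathsf u)\circ(\psi,\mathsf v)$ are approximately inner on $(A,\alpha)$ and $(B,\beta)$, respectively. Then $(\phi,\mathsf u)$ and $(\psi,\mathsf v)$ are approximately unitarily equivalent to mutually inverse cocycle conjugacies between $(A,\alpha)$ and $(B,\beta)$.
   Context: $\mathcal M(B)$ is the multiplier algebra of $B$, $\mathcal U(\cdot)$ denotes the unitary group, $\mathrm{Ad}(u)=u(\cdot)u^*$. A $G$-C*-algebra $(A,\alpha)$ is a C*-algebra $A$ with a point-norm continuous action $\alpha:G\curvearrowright A$; $\alpha$ is extended canonically to $\mathcal M(A)$. A cocycle morphism $(\phi,\mathsf u):(A,\alpha)\to(B,\beta)$ is a pair consisting of a $*$-homomorphism $\phi:A\to B$ and a strictly continuous $\beta$-cocycle $\mathsf u:G\to\mathcal U(\mathcal M(B))$ (i.e. $\mathsf u_{gh}=\mathsf u_g\beta_g(\mathsf u_h)$) with $\mathrm{Ad}(\mathsf u_g)\circ\beta_g\circ\phi=\phi\circ\alpha_g$ for all $g\in G$. It is non-degenerate if $\phi$ is; then $\phi$ extends to a unital strictly continuous $*$-homomorphism $\mathcal M(A)\to\mathcal M(B)$. Composition of non-degenerate cocycle morphisms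 is $(\psi,\mathsf v)\circ(\phi,\mathsf u)=(\psi\circ\phi,\psi(\mathsf u_\bullet)\mathsf v_\bullet)$. A cocycle conjugacy is a cocycle morphism $(\phi,\mathsf u)$ for which $\phi$ is an isomorphism; its inverse is $(\phi^{-1},\phi^{-1}(\mathsf u_\bullet)^* )$. For non-degenerate cocycle morphisms $(\phi,\mathsf u),(\psi,\mathsf v):(A,\alpha)\to(B,\beta)$, say that $(\phi,\mathsf u)$ is approximately unitarily equivalent to $(\psi,\mathsf v)$ if there is a net of unitaries $u_\lambda\in\mathcal U(\mathcal M(B))$ such that $u_\lambda\phi(a)u_\lambda^*\to\psi(a)$ in norm for all $a\in A$ and $\max_{g\in K}\|b(\mathsf v_g-u_\lambda\mathsf u_g\beta_g(u_\lambda)^* )\|\to0$ for all $b\in B$ and all compact $K\subseteq G$ (this relation is symmetric for non-degenerate cocycle morphisms). A cocycle morphism $(\psi,\mathsf v):(A,\alpha)\to(A,\alpha)$ is approximately inner if $(\mathrm{id}_A,\mathbf 1)$ is approximately unitarily equivalent to $(\psi,\mathsf v)$. *)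

theory Defs
  imports "HOL-Analysis.Analysis"
begin

section \<open>C*-algebras\<close>

class star =
  fixes star :: "'a \<Rightarrow> 'a"

text \<open>
  Possibly non-unital complex C*-algebras. The distribution only has real normed algebras,
  so the complex scalar multiplication is added here; it restricts to \<^term>\<open>scaleR\<close>.
  The zero algebra is allowed.
\<close>

class cstar_algebra = banach + real_normed_algebra + star +
  fixes scaleC :: "complex \<Rightarrow> 'a \<Rightarrow> 'a"  (infixr \<open>*\<^sub>C\<close> 75)
  assumes scaleC_add_right: "c *\<^sub>C (x + y) = c *\<^sub>C x + c *\<^sub>C y"
    and scaleC_add_left: "(c + d) *\<^sub>C x = c *\<^sub>C x + d *\<^sub>C x"
    and scaleC_scaleC: "c *\<^sub>C d *\<^sub>C x = (c * d) *\<^sub>C x"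
    and scaleR_scaleC: "r *\<^sub>R x = complex_of_real r *\<^sub>C x"
    and norm_scaleC: "norm (c *\<^sub>C x) = cmod c * norm x"
    and mult_scaleC_left: "(c *\<^sub>C x) * y = c *\<^sub>C (x * y)"
    and mult_scaleC_right: "x * (c *\<^sub>C y) = c *\<^sub>C (x * y)"
    and star_star: "star (star x) = x"
    and star_add: "star (x + y) = star x + star y"
    and star_scaleC: "star (c *\<^sub>C x) = cnj c *\<^sub>C star x"
    and star_mult: "star (x * y) = star y * star x"
    and cstar_identity: "norm (star x * x) = (norm x)\<^sup>2"

lemma scaleC_minus_right: "c *\<^sub>C (- x) = - (c *\<^sub>C (x::'a::cstar_algebra))"
  using scaleC_add_right[of c x "- x"] scaleC_add_right[of c 0 "0::'a"]
  by (simp add: eq_neg_iff_add_eq_0 add.commute)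

lemma scaleC_zero_right: "c *\<^sub>C (0::'a::cstar_algebra) = 0"
  using scaleC_add_right[of c 0 "0::'a"] by simp

lemma star_minus: "star (x - y) = star x - star (y::'a::cstar_algebra)"
  using star_add[of "x - y" y] by (simp add: algebra_simps)

lemma star_zero: "star (0::'a::cstar_algebra) = 0"
  using star_minus[of "0::'a" 0] by simp

lemma norm_star: "norm (star x) = norm (x::'a::cstar_algebra)"
proof -
  have *: "norm y \<le> norm (star y)" for y :: 'a
  proof (cases "y = 0")
    case False
    have "norm y * norm y = norm (star y * y)"
      by (simp add: cstar_identity power2_eq_square)
    also have "\<dots> \<le> norm (star y) * norm y"
      by (rule norm_mult_ineq)
    finally show ?thesis using False by simp
  qed (simp add: star_zero)
  from *[of x] *[of "star x"] show ?thesis by (simp add: star_star)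
qed

lemma bounded_linear_star: "bounded_linear (star :: 'a::cstar_algebra \<Rightarrow> 'a)"
  by (rule bounded_linear_intro[where K = 1])
    (simp_all add: star_add scaleR_scaleC star_scaleC norm_star)

lemma left_faithful: "a = (0::'a::cstar_algebra)" if "\<And>x. x * a = 0"
  using cstar_identity[of a] that by simp

lemma right_faithful: "a = (0::'a::cstar_algebra)" if "\<And>x. a * x = 0"
  using cstar_identity[of "star a"] that by (simp add: star_star norm_star)

definition star_hom :: "('a::cstar_algebra \<Rightarrow> 'b::cstar_algebra) \<Rightarrow> bool" where
  "star_hom \<phi> \<longleftrightarrow>
     (\<forall>x y. \<phi> (x + y) = \<phi> x + \<phi> y) \<and> (\<forall>c x. \<phi> (c *\<^sub>C x) = c *\<^sub>C \<phi> x) \<and>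
     (\<forall>x y. \<phi> (x * y) = \<phi> x * \<phi> y) \<and> (\<forall>x. \<phi> (star x) = star (\<phi> x))"

text \<open>
  The real linear span suffices here, as the set of products is closed under complex scaling.
\<close>

definition nondegenerate :: "('a::cstar_algebra \<Rightarrow> 'b::cstar_algebra) \<Rightarrow> bool" where
  "nondegenerate \<phi> \<longleftrightarrow> closure (span {\<phi> a * b |a b. True}) = UNIV"


section \<open>The multiplier algebra\<close>

definition bounded_clinear :: "('a::cstar_algebra \<Rightarrow> 'a) \<Rightarrow> bool" where
  "bounded_clinear f \<longleftrightarrow> bounded_linear f \<and> (\<forall>c x. f (c *\<^sub>C x) = c *\<^sub>C f x)"

text \<open>
  Multipliers are double centralizers \<open>m = (L, R)\<close>, where \<open>L x\<close> is the product
  \<open>m x\<close> and \<open>R x\<close> is the product \<open>x m\<close>.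
\<close>

typedef (overloaded) 'a::cstar_algebra multiplier =
  "{(L, R) :: ('a \<Rightarrow> 'a) \<times> ('a \<Rightarrow> 'a) | L R.
      bounded_clinear L \<and> bounded_clinear R \<and> (\<forall>x y. x * L y = R x * y)}"
  by (rule exI[of _ "(id, id)"]) (simp add: bounded_clinear_def id_def)

setup_lifting type_definition_multiplier

lift_definition lmult :: "'a::cstar_algebra multiplier \<Rightarrow> 'a \<Rightarrow> 'a"  (infixr \<open>\<rhd>\<close> 72)
  is fst .

lift_definition rmult :: "'a::cstar_algebra \<Rightarrow> 'a multiplier \<Rightarrow> 'a"  (infixl \<open>\<lhd>\<close> 71)
  is "\<lambda>x m. snd m x" .

lift_definition of_alg :: "'a::cstar_algebra \<Rightarrow> 'a multiplier"
  is "\<lambda>a. (\<lambda>x. a * x, \<lambda>x. x * a)"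
  by (simp add: bounded_clinear_def mult_scaleC_left mult_scaleC_right bounded_linear_mult_left
      bounded_linear_mult_right mult.assoc)

lemma bounded_clinear_star: "bounded_clinear (\<lambda>x. star (f (star x)))" if "bounded_clinear f"
  using that bounded_linear_compose[OF bounded_linear_star
      bounded_linear_compose[OF _ bounded_linear_star], of f]
  by (simp add: bounded_clinear_def star_scaleC)

lemma double_centralizer_star:
  assumes "\<forall>x y. x * L y = R x * (y::'a::cstar_algebra)"
  shows "x * star (R (star y)) = star (L (star x)) * y"
proof -
  have "star (star y * L (star x)) = star (R (star y) * star x)"
    using assms by simp
  then show ?thesis by (simp add: star_mult star_star)
qed

instantiation multiplier :: (cstar_algebra) "{zero, one, plus, minus, uminus, times, star}"
begin

lift_definition zero_multiplier :: "'a multiplier" is "(\<lambda>_. 0, \<lambda>_. 0)"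
  by (simp add: bounded_clinear_def scaleC_zero_right)

lift_definition one_multiplier :: "'a multiplier" is "(\<lambda>x. x, \<lambda>x. x)"
  by (simp add: bounded_clinear_def)

lift_definition plus_multiplier :: "'a multiplier \<Rightarrow> 'a multiplier \<Rightarrow> 'a multiplier"
  is "\<lambda>m n. (\<lambda>x. fst m x + fst n x, \<lambda>x. snd m x + snd n x)"
  by (auto simp: bounded_clinear_def bounded_linear_add scaleC_add_right algebra_simps)

lift_definition uminus_multiplier :: "'a multiplier \<Rightarrow> 'a multiplier"
  is "\<lambda>m. (\<lambda>x. - fst m x, \<lambda>x. - snd m x)"
  by (auto simp: bounded_clinear_def bounded_linear_minus scaleC_minus_right)

definition minus_multiplier :: "'a multiplier \<Rightarrow> 'a multiplier \<Rightarrow> 'a multiplier" where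
  "minus_multiplier m n = m + - n"

lift_definition times_multiplier :: "'a multiplier \<Rightarrow> 'a multiplier \<Rightarrow> 'a multiplier"
  is "\<lambda>m n. (\<lambda>x. fst m (fst n x), \<lambda>x. snd n (snd m x))"
  by (auto simp: bounded_clinear_def bounded_linear_compose)

lift_definition star_multiplier :: "'a multiplier \<Rightarrow> 'a multiplier"
  is "\<lambda>m. (\<lambda>x. star (snd m (star x)), \<lambda>x. star (fst m (star x)))"
  by (auto simp: bounded_clinear_star double_centralizer_star)

instance ..

end

lemma mult_lmult: "x * (m \<rhd> y) = (x \<lhd> m) * y"
  by transfer auto

lemma multiplier_eqI:
  assumes "\<And>x. m \<rhd> x = n \<rhd> x"
  shows "m = n"
proof -
  have "x \<lhd> m = x \<lhd> n" for x
  proof -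
    have "(x \<lhd> m - x \<lhd> n) * y = 0" for y
      using mult_lmult[of x m y] mult_lmult[of x n y] assms[of y] by (simp add: algebra_simps)
    from right_faithful[OF this] show ?thesis by simp
  qed
  with assms show ?thesis
    unfolding Rep_multiplier_inject[symmetric] prod_eq_iff fun_eq_iff
    by (simp add: lmult.rep_eq rmult.rep_eq)
qed

lemma lmult_simps [simp]:
  "0 \<rhd> x = 0" "1 \<rhd> x = x" "(m + n) \<rhd> x = m \<rhd> x + n \<rhd> x"
  "(- m) \<rhd> x = - (m \<rhd> x)" "(m - n) \<rhd> x = m \<rhd> x - n \<rhd> x"
  "(m * n) \<rhd> x = m \<rhd> n \<rhd> x" "star m \<rhd> x = star (star x \<lhd> m)"
  "of_alg a \<rhd> x = a * x"
  by (simp_all add: minus_multiplier_def lmult.rep_eq rmult.rep_eq of_alg.rep_eq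
      zero_multiplier.rep_eq one_multiplier.rep_eq plus_multiplier.rep_eq uminus_multiplier.rep_eq
      times_multiplier.rep_eq star_multiplier.rep_eq)

lemma rmult_simps [simp]:
  "x \<lhd> 0 = 0" "x \<lhd> 1 = x" "x \<lhd> (m + n) = x \<lhd> m + x \<lhd> n"
  "x \<lhd> (- m) = - (x \<lhd> m)" "x \<lhd> (m - n) = x \<lhd> m - x \<lhd> n"
  "x \<lhd> (m * n) = x \<lhd> m \<lhd> n" "x \<lhd> star m = star (m \<rhd> star x)"
  "x \<lhd> of_alg a = x * a"
  by (simp_all add: minus_multiplier_def lmult.rep_eq rmult.rep_eq of_alg.rep_eq
      zero_multiplier.rep_eq one_multiplier.rep_eq plus_multiplier.rep_eq uminus_multiplier.rep_eq
      times_multiplier.rep_eq star_multiplier.rep_eq)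

lemma bounded_linear_lmult: "bounded_linear ((\<rhd>) m)"
  by transfer (auto simp: bounded_clinear_def)

instance multiplier :: (cstar_algebra) "{ring, monoid_mult}"
proof
  fix a b c :: "'a multiplier"
  show "a * (b + c) = a * b + a * c"
    by (rule multiplier_eqI) (simp add: linear_add bounded_linear.linear[OF bounded_linear_lmult])
qed (rule multiplier_eqI, simp add: algebra_simps)+

definition unitary :: "'a::cstar_algebra multiplier \<Rightarrow> bool" where
  "unitary u \<longleftrightarrow> star u * u = 1 \<and> u * star u = 1"

definition Ad :: "'a::cstar_algebra multiplier \<Rightarrow> 'a \<Rightarrow> 'a" where
  "Ad u a = (u \<rhd> a) \<lhd> star u"

definition strictly_continuous :: "('g::topological_space \<Rightarrow> 'a::cstar_algebra multiplier) \<Rightarrow> bool" where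
  "strictly_continuous u \<longleftrightarrow>
     (\<forall>a. continuous_on UNIV (\<lambda>g. u g \<rhd> a) \<and> continuous_on UNIV (\<lambda>g. a \<lhd> u g))"

text \<open>
  The canonical extension of a non-degenerate *-homomorphism \<open>\<phi> : A \<rightarrow> B\<close> to the multiplier
  algebras: \<open>\<phi>(m)\<close> is the multiplier of \<open>B\<close> acting by \<open>\<phi>(m) \<phi>(a) b = \<phi>(m a) b\<close>. By the
  lemmas below it is unique, and every multiplicative map between the multiplier algebras
  extending \<open>\<phi>\<close> coincides with it.
\<close>

definition mult_ext :: "('a::cstar_algebra \<Rightarrow> 'b::cstar_algebra) \<Rightarrow> 'a multiplier \<Rightarrow> 'b multiplier" where
  "mult_ext \<phi> m = (THE n. \<forall>a b. n \<rhd> (\<phi> a * b) = \<phi> (m \<rhd> a) * b)"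

lemma mult_ext_eqI:
  assumes "nondegenerate \<phi>" and n: "\<And>a b. n \<rhd> (\<phi> a * b) = \<phi> (m \<rhd> a) * b"
  shows "mult_ext \<phi> m = n"
  unfolding mult_ext_def
proof (rule the_equality)
  fix n' assume n': "\<forall>a b. n' \<rhd> (\<phi> a * b) = \<phi> (m \<rhd> a) * b"
  let ?S = "{\<phi> a * b |a b. True}"
  have lin: "linear ((\<rhd>) n')" "linear ((\<rhd>) n)"
    by (simp_all add: bounded_linear.linear bounded_linear_lmult)
  have "n' \<rhd> x = n \<rhd> x" for x
  proof -
    have "n' \<rhd> x - n \<rhd> x = 0"
    proof (rule continuous_constant_on_closure[where f = "\<lambda>y. n' \<rhd> y - n \<rhd> y" and S = "span ?S"])
      show "n' \<rhd> y - n \<rhd> y = 0" if "y \<in> span ?S" for y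
        using linear_eq_on_span[OF lin _ that] n n' by fastforce
      show "continuous_on (closure (span ?S)) (\<lambda>y. n' \<rhd> y - n \<rhd> y)"
        by (intro continuous_on_diff linear_continuous_on bounded_linear_lmult)
      show "x \<in> closure (span ?S)"
        using assms(1) by (simp add: nondegenerate_def)
    qed
    then show ?thesis by simp
  qed
  then show "n' = n" by (rule multiplier_eqI)
qed (use n in simp)

lemma mult_ext_unique_extension:
  assumes "nondegenerate \<phi>" and mult: "\<And>m n. \<Phi> (m * n) = \<Phi> m * \<Phi> n"
    and ext: "\<And>a. \<Phi> (of_alg a) = of_alg (\<phi> a)"
  shows "mult_ext \<phi> = \<Phi>"
proof
  fix m :: "'a multiplier"
  show "mult_ext \<phi> m = \<Phi> m"
  proof (rule mult_ext_eqI[OF assms(1)])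
    fix a b
    have *: "m * of_alg a = of_alg (m \<rhd> a)"
    proof (rule multiplier_eqI)
      fix x
      have "y * (m \<rhd> (a * x) - (m \<rhd> a) * x) = 0" for y
        by (simp add: right_diff_distrib mult_lmult flip: mult.assoc)
      from left_faithful[OF this] show "(m * of_alg a) \<rhd> x = of_alg (m \<rhd> a) \<rhd> x" by simp
    qed
    have "\<Phi> m * of_alg (\<phi> a) = of_alg (\<phi> (m \<rhd> a))"
      using mult[of m "of_alg a"] by (simp add: * ext)
    then have "(\<Phi> m * of_alg (\<phi> a)) \<rhd> b = of_alg (\<phi> (m \<rhd> a)) \<rhd> b" by simp
    then show "\<Phi> m \<rhd> (\<phi> a * b) = \<phi> (m \<rhd> a) * b" by simp
  qed
qed


section \<open>Actions and cocycle morphisms\<close>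

text \<open>
  Groups are written additively, following the class \<^class>\<open>topological_group_add\<close>, whose
  groups are not assumed to be commutative: \<open>g + h\<close>, \<open>0\<close> and \<open>- g\<close> are the product,
  neutral element and inverse.
\<close>

definition cstar_action :: "('g::topological_group_add \<Rightarrow> 'a::cstar_algebra \<Rightarrow> 'a) \<Rightarrow> bool" where
  "cstar_action \<alpha> \<longleftrightarrow>
     (\<forall>g. star_hom (\<alpha> g) \<and> bij (\<alpha> g)) \<and>
     \<alpha> 0 = id \<and> (\<forall>g h. \<alpha> (g + h) = \<alpha> g \<circ> \<alpha> h) \<and>
     (\<forall>a. continuous_on UNIV (\<lambda>g. \<alpha> g a))"

definition cocycle ::
  "('g::topological_group_add \<Rightarrow> 'b::cstar_algebra \<Rightarrow> 'b) \<Rightarrow> ('g \<Rightarrow> 'b multiplier) \<Rightarrow> bool" where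
  "cocycle \<beta> u \<longleftrightarrow>
     (\<forall>g. unitary (u g)) \<and> strictly_continuous u \<and>
     (\<forall>g h. u (g + h) = u g * mult_ext (\<beta> g) (u h))"

type_synonym ('g, 'a, 'b) cocycle_pair = "('a \<Rightarrow> 'b) \<times> ('g \<Rightarrow> 'b multiplier)"

definition cocycle_morphism ::
  "('g::topological_group_add \<Rightarrow> 'a::cstar_algebra \<Rightarrow> 'a) \<Rightarrow> ('g \<Rightarrow> 'b::cstar_algebra \<Rightarrow> 'b) \<Rightarrow>
   ('g, 'a, 'b) cocycle_pair \<Rightarrow> bool" where
  "cocycle_morphism \<alpha> \<beta> = (\<lambda>(\<phi>, u).
     star_hom \<phi> \<and> cocycle \<beta> u \<and> (\<forall>g. Ad (u g) \<circ> \<beta> g \<circ> \<phi> = \<phi> \<circ> \<alpha> g))"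

definition nondegenerate_cocycle_morphism ::
  "('g::topological_group_add \<Rightarrow> 'a::cstar_algebra \<Rightarrow> 'a) \<Rightarrow> ('g \<Rightarrow> 'b::cstar_algebra \<Rightarrow> 'b) \<Rightarrow>
   ('g, 'a, 'b) cocycle_pair \<Rightarrow> bool" where
  "nondegenerate_cocycle_morphism \<alpha> \<beta> X \<longleftrightarrow> cocycle_morphism \<alpha> \<beta> X \<and> nondegenerate (fst X)"

definition cocycle_conjugacy ::
  "('g::topological_group_add \<Rightarrow> 'a::cstar_algebra \<Rightarrow> 'a) \<Rightarrow> ('g \<Rightarrow> 'b::cstar_algebra \<Rightarrow> 'b) \<Rightarrow>
   ('g, 'a, 'b) cocycle_pair \<Rightarrow> bool" where
  "cocycle_conjugacy \<alpha> \<beta> X \<longleftrightarrow> cocycle_morphism \<alpha> \<beta> X \<and> bij (fst X)"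

definition cocycle_id :: "('g, 'a::cstar_algebra, 'a) cocycle_pair" where
  "cocycle_id = (id, \<lambda>_. 1)"

definition cocycle_comp ::
  "('g, 'b::cstar_algebra, 'c::cstar_algebra) cocycle_pair \<Rightarrow> ('g, 'a::cstar_algebra, 'b) cocycle_pair \<Rightarrow>
   ('g, 'a, 'c) cocycle_pair" where
  "cocycle_comp = (\<lambda>(\<psi>, v) (\<phi>, u). (\<psi> \<circ> \<phi>, \<lambda>g. mult_ext \<psi> (u g) * v g))"

definition cocycle_inverse ::
  "('g, 'a::cstar_algebra, 'b::cstar_algebra) cocycle_pair \<Rightarrow> ('g, 'b, 'a) cocycle_pair" where
  "cocycle_inverse = (\<lambda>(\<phi>, u). (inv \<phi>, \<lambda>g. star (mult_ext (inv \<phi>) (u g))))"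

text \<open>
  Nets of unitaries are rendered as proper filters on the multiplier algebra that contain the
  set of unitaries: a net yields its filter of eventually-true properties, and every proper
  filter arises from a net. The convergence of the maximum over a compact set
  to \<open>0\<close> is uniform convergence on that set.
\<close>

definition approx_unitarily_equiv ::
  "('g::topological_group_add \<Rightarrow> 'b::cstar_algebra \<Rightarrow> 'b) \<Rightarrow>
   ('g, 'a::cstar_algebra, 'b) cocycle_pair \<Rightarrow> ('g, 'a, 'b) cocycle_pair \<Rightarrow> bool" where
  "approx_unitarily_equiv \<beta> = (\<lambda>(\<phi>, u) (\<psi>, v).
     \<exists>F :: 'b multiplier filter. F \<noteq> bot \<and> eventually unitary F \<and>
       (\<forall>a. ((\<lambda>w. Ad w (\<phi> a)) \<longlongrightarrow> \<psi> a) F) \<and>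
       (\<forall>b K. compact K \<longrightarrow>
         uniform_limit K (\<lambda>w g. b \<lhd> (v g - w * u g * star (mult_ext (\<beta> g) w))) (\<lambda>g. 0) F))"

definition approx_inner ::
  "('g::topological_group_add \<Rightarrow> 'a::cstar_algebra \<Rightarrow> 'a) \<Rightarrow> ('g, 'a, 'a) cocycle_pair \<Rightarrow> bool" where
  "approx_inner \<alpha> X \<longleftrightarrow> approx_unitarily_equiv \<alpha> cocycle_id X"

end

theory Submission
  imports Defs
begin

text \<open>
  A cocycle morphism \<open>(\<phi>, u)\<close> is encoded by its fibre maps \<open>T\<^sub>g(a) = \<phi>(a) u\<^sub>g\<close>. This turns
  multiplier-valued cocycles into contractive linear maps between C*-algebras: composition of
  non-degenerate cocycle morphisms becomes composition of \<open>T\<^sub>g\<close> for each \<open>g\<close> separately, and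
  conjugation by a unitary \<open>w\<close> becomes \<open>T\<^sub>g(a) \<mapsto> w T\<^sub>g(a) \<beta>\<^sub>g(w)\<^sup>*\<close>. The point
  of testing the cocycle \<open>u\<close> only against elements \<open>\<phi>(a)\<close> is that the distance between two families
  of fibre maps, measured on given elements and a given compact set of \<open>g\<close>, does not increase when a
  further morphism is applied to both. (Measured by \<open>\<parallel>b (u\<^sub>g - u'\<^sub>g)\<parallel>\<close> for fixed \<open>b\<close>, it could
  increase in a way that depends on the further morphism.)

  With this contractivity, Elliott's two-sided approximate intertwining is a statement about
  complete separable metric spaces, \<open>two_sided_approximate_intertwining\<close>: two sets of
  families of contractions, each of whose members has approximate left inverses in the other, contain
  sequences that converge to mutually inverse families. It is applied to the orbits of \<open>(\<phi>, u)\<close>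
  and \<open>(\<psi>, v)\<close> under unitary conjugation. Approximate innerness of the two compositions supplies the
  approximate inverses, by \<open>bundle_orbit_approx_inverse\<close>.

  The limit is again a morphism of Fell bundles, that is, it satisfies the algebraic identities
  of fibre maps, as these are closed conditions. That it comes from a cocycle morphism
  is not clear for general limits, since the limit cocycle has to be found in the multiplier
  algebra; but the limit is invertible, and then the cocycle can be written down
  (\<open>bundle_iso_cocycle\<close>). Translating convergence of fibre maps back
  (\<open>approx_unitarily_equivI\<close>) finishes the argument.

  Two facts from C*-algebra theory are needed along the way: *-homomorphisms are contractive
  (\<open>star_hom_norm_le\<close>), and a non-degenerate *-homomorphism extends to unitary multipliers
  (\<open>mult_ext_unitary_lmult\<close>, \<open>mult_ext_unitary_rmult\<close>).
\<close>


section \<open>Contractivity of *-homomorphisms\<close>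

lemma scaleC_1 [simp]: "1 *\<^sub>C x = (x::'a::cstar_algebra)"
  using scaleR_scaleC[of 1 x] by simp

lemma scaleC_minus_left: "(- c) *\<^sub>C x = - (c *\<^sub>C (x::'a::cstar_algebra))"
  using scaleC_scaleC[of "-1" c x] scaleR_scaleC[of "-1" "c *\<^sub>C x"] by simp

lemma scaleC_diff_right: "c *\<^sub>C (x - y) = c *\<^sub>C x - c *\<^sub>C (y::'a::cstar_algebra)"
  using scaleC_add_right[of c x "- y"] by (simp add: scaleC_minus_right)

lemma bounded_linear_scaleC: "bounded_linear ((*\<^sub>C) c :: 'a::cstar_algebra \<Rightarrow> 'a)"
  by (rule bounded_linear_intro[where K = "cmod c"])
    (simp_all add: scaleC_add_right scaleR_scaleC scaleC_scaleC mult.commute norm_scaleC)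

lemma star_scaleR: "star (r *\<^sub>R x) = r *\<^sub>R star (x::'a::cstar_algebra)"
  by (simp add: scaleR_scaleC star_scaleC)

text \<open>
  A self-adjoint \<open>h\<close> of norm less than \<open>1\<close> is the real part of the unitary
  \<open>h + \<i> (1 - k)\<close> with \<open>1 - k = (1 - h\<^sup>2)\<^bsup>1/2\<^esup>\<close>. Without a unit at hand, \<open>k\<close> itself is
  constructed: the circle equation \<open>h\<^sup>2 + (1 - k)\<^sup>2 = 1\<close> says that \<open>k\<close> is a fixed point of
  \<open>k \<mapsto> (h\<^sup>2 + k\<^sup>2) / 2\<close>, which is a contraction on the elements of norm at most \<open>\<parallel>h\<parallel>\<close>
  that are self-adjoint and commute with \<open>h\<close>.
\<close>

lemma circle_point_exists:
  fixes h :: "'a::cstar_algebra"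
  assumes "star h = h" and "norm h < 1"
  obtains k where "star k = k" "k * h = h * k" "h * h + k * k = k + k"
proof -
  let ?S = "{k. norm k \<le> norm h \<and> star k = k \<and> k * h = h * k}"
  let ?f = "\<lambda>k. (1/2) *\<^sub>R (h * h + k * k)"
  have "closed ?S"
    by (intro closed_Collect_conj closed_Collect_le closed_Collect_eq continuous_intros
        linear_continuous_on bounded_linear_star)
  then have "complete ?S" by (simp add: complete_eq_closed)
  moreover have "0 \<in> ?S" by (simp add: star_zero)
  moreover have "?f ` ?S \<subseteq> ?S"
  proof (intro image_subsetI CollectI conjI; clarify)
    fix k assume k: "norm k \<le> norm h" "star k = k" "k * h = h * k"
    have "norm (h * h) \<le> norm h * norm h" "norm (k * k) \<le> norm h * norm h"
      using norm_mult_ineq[of h h] norm_mult_ineq[of k k] mult_mono[OF k(1) k(1)] by auto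
    then have "norm (h * h + k * k) \<le> 2 * (norm h * norm h)"
      using norm_triangle_ineq[of "h * h" "k * k"] by linarith
    moreover have "norm h * norm h \<le> norm h"
      using assms(2) by (simp add: mult_left_le)
    ultimately show "norm (?f k) \<le> norm h" by simp
    show "star (?f k) = ?f k" using k assms by (simp add: star_scaleR star_add star_mult)
    have "k * k * h = h * (k * k)" using k(3) by (metis mult.assoc)
    then show "?f k * h = h * ?f k" by (simp add: algebra_simps)
  qed
  moreover have "dist (?f k) (?f l) \<le> norm h * dist k l" if "k \<in> ?S" "l \<in> ?S" for k l
  proof -
    have "norm (k * k - l * l) = norm (k * (k - l) + (k - l) * l)" by (simp add: algebra_simps)
    also have "\<dots> \<le> norm k * norm (k - l) + norm (k - l) * norm l"
      by (intro norm_triangle_le add_mono norm_mult_ineq)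
    also have "\<dots> \<le> norm h * norm (k - l) + norm (k - l) * norm h"
      using that by (intro add_mono mult_mono) auto
    finally have "norm (k * k - l * l) \<le> 2 * (norm h * norm (k - l))" by simp
    moreover have "?f k - ?f l = (1/2) *\<^sub>R (k * k - l * l)"
      by (simp flip: scaleR_diff_right)
    ultimately show ?thesis by (simp add: dist_norm)
  qed
  ultimately have "\<exists>!k. k \<in> ?S \<and> ?f k = k"
    using assms(2) by (intro Banach_fix[where c = "norm h"]) auto
  then obtain k where k: "k \<in> ?S" "?f k = k" by auto
  have "h * h + k * k = 2 *\<^sub>R ?f k" by simp
  also have "\<dots> = k + k" by (simp only: k(2) scaleR_2)
  finally show ?thesis using k(1) that by blast
qed

text \<open>
  This is left multiplication by the unitary \<open>h + \<i> (1 - k)\<close>, written without a unit.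
\<close>

lemma circle_point_isometry:
  fixes h k x :: "'a::cstar_algebra"
  assumes "star h = h" "star k = k" "k * h = h * k" and hk: "h * h + k * k = k + k"
  shows "norm (h * x + \<i> *\<^sub>C (x - k * x)) = norm x"
proof -
  let ?a = "h * x" and ?d = "x - k * x"
  have khx: "k * (h * y) = h * (k * y)" for y using assms(3) by (metis mult.assoc)
  have hhx: "h * (h * y) = k * y + k * y - k * (k * y)" for y
    using arg_cong[OF hk, of "\<lambda>z. z * y"] by (simp add: algebra_simps)
  have "star (a + \<i> *\<^sub>C d) * (a + \<i> *\<^sub>C d) =
      star a * a + star d * d + \<i> *\<^sub>C (star a * d - star d * a)" for a d :: 'a
    by (simp add: star_add star_scaleC algebra_simps mult_scaleC_left mult_scaleC_right
        scaleC_scaleC scaleC_diff_right scaleC_minus_left scaleC_minus_right)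
  then have "star (?a + \<i> *\<^sub>C ?d) * (?a + \<i> *\<^sub>C ?d) =
      star ?a * ?a + star ?d * ?d + \<i> *\<^sub>C (star ?a * ?d - star ?d * ?a)" .
  also have "star ?a * ?d - star ?d * ?a = 0"
    using assms by (simp add: star_minus star_mult algebra_simps khx)
  also have "star ?a * ?a + star ?d * ?d = star x * x"
    using assms by (simp add: star_minus star_mult algebra_simps hhx)
  finally have "norm (star (?a + \<i> *\<^sub>C ?d) * (?a + \<i> *\<^sub>C ?d)) = norm (star x * x)"
    by (simp add: scaleC_zero_right)
  then show ?thesis unfolding cstar_identity by simp
qed

text \<open>
  \<open>h\<close> is the average of two unitaries, so multiplication by it cannot increase the norm of
  \<open>h\<close>; hence \<open>\<parallel>h\<parallel>\<^sup>2 = \<parallel>h\<^sup>2\<parallel> \<le> \<parallel>h\<parallel>\<close>. The hypotheses are purely algebraic, and so they survive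
  *-homomorphisms.
\<close>

lemma circle_point_norm_le_1:
  fixes h k :: "'a::cstar_algebra"
  assumes "star h = h" "star k = k" "k * h = h * k" "h * h + k * k = k + k"
  shows "norm h \<le> 1"
proof (cases "h = 0")
  case False
  let ?U = "\<i> *\<^sub>C (h - k * h)"
  have "norm (h * h + ?U) = norm h" using circle_point_isometry[OF assms] .
  moreover have "norm ((- h) * h + ?U) = norm h"
    using assms by (intro circle_point_isometry) (simp_all add: star_minus[of 0, simplified] star_zero)
  moreover have "2 *\<^sub>R (h * h) = (h * h + ?U) - ((- h) * h + ?U)"
    by (simp add: scaleR_2)
  ultimately have "norm (2 *\<^sub>R (h * h)) \<le> norm h + norm h"
    by (metis norm_triangle_ineq4)
  then have "norm (h * h) \<le> norm h" by simp
  moreover have "norm (h * h) = norm h * norm h"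
    using cstar_identity[of h] assms(1) by (simp add: power2_eq_square)
  ultimately show ?thesis using False by simp
qed simp

lemma star_homD:
  assumes "star_hom \<phi>"
  shows "\<phi> (x + y) = \<phi> x + \<phi> y" "\<phi> (c *\<^sub>C x) = c *\<^sub>C \<phi> x"
    "\<phi> (x * y) = \<phi> x * \<phi> y" "\<phi> (star x) = star (\<phi> x)"
  using assms by (auto simp: star_hom_def)

text \<open>
  If \<open>\<parallel>h\<parallel> < 1\<close> then \<open>h\<close> has a partner \<open>k\<close> on the circle, and \<open>\<phi> k\<close> is a partner for \<open>\<phi> h\<close>,
  so that \<open>\<parallel>\<phi> h\<parallel> \<le> 1\<close>. Scaling and the C*-identity do the rest.
\<close>

lemma star_hom_norm_le:
  assumes \<phi>: "star_hom \<phi>"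
  shows "norm (\<phi> x) \<le> norm x"
proof -
  have scale: "\<phi> (r *\<^sub>R y) = r *\<^sub>R \<phi> y" for r y
    by (simp add: scaleR_scaleC star_homD[OF \<phi>])
  have unit: "norm (\<phi> h) \<le> 1" if h: "star h = h" "norm h < 1" for h
  proof -
    obtain k where "star k = k" "k * h = h * k" "h * h + k * k = k + k"
      using circle_point_exists[OF h] .
    then show ?thesis
      using h by (intro circle_point_norm_le_1[of "\<phi> h" "\<phi> k"]) (metis star_homD[OF \<phi>])+
  qed
  have sa: "norm (\<phi> h) \<le> norm h" if "star h = h" for h
  proof (rule dense_ge)
    fix t assume t: "norm h < t"
    then have "0 < t" using norm_ge_zero le_less_trans by blast
    then have "norm (\<phi> ((1/t) *\<^sub>R h)) \<le> 1"
      using t that by (intro unit) (auto simp: star_scaleR)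
    then show "norm (\<phi> h) \<le> t" using \<open>0 < t\<close> by (simp add: scale field_simps)
  qed
  have "(norm (\<phi> x))\<^sup>2 = norm (\<phi> (star x * x))"
    by (simp add: star_homD[OF \<phi>] cstar_identity)
  also have "\<dots> \<le> norm (star x * x)" by (rule sa) (simp add: star_mult star_star)
  finally show ?thesis by (simp add: cstar_identity)
qed

lemma star_hom_bounded_linear: "bounded_linear \<phi>" if "star_hom \<phi>"
  using that star_hom_norm_le[OF that]
  by (intro bounded_linear_intro[where K = 1]) (simp_all add: star_homD scaleR_scaleC)


section \<open>Multipliers and extensions of non-degenerate homomorphisms\<close>

lemma lmult_mult: "m \<rhd> (x * y) = (m \<rhd> x) * (y::'a::cstar_algebra)"
proof -
  have "z * (m \<rhd> (x * y) - (m \<rhd> x) * y) = 0" for z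
    by (simp add: right_diff_distrib mult_lmult flip: mult.assoc)
  from left_faithful[OF this] show ?thesis by simp
qed

lemma rmult_mult: "(x * y) \<lhd> m = x * (y \<lhd> m)" for x :: "'a::cstar_algebra"
proof -
  have "((x * y) \<lhd> m - x * (y \<lhd> m)) * z = 0" for z
    by (simp add: left_diff_distrib mult.assoc flip: mult_lmult)
  from right_faithful[OF this] show ?thesis by simp
qed

lemma lmult_rmult: "(m \<rhd> x) \<lhd> n = m \<rhd> (x \<lhd> n)" for x :: "'a::cstar_algebra"
proof -
  have "z * ((m \<rhd> x) \<lhd> n - m \<rhd> (x \<lhd> n)) = 0" for z
    by (simp add: right_diff_distrib mult_lmult flip: rmult_mult)
  from left_faithful[OF this] show ?thesis by simp
qed

lemma bounded_linear_rmult: "bounded_linear (\<lambda>x. x \<lhd> m)"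
  by transfer (auto simp: bounded_clinear_def)

lemma lmult_scaleC: "m \<rhd> c *\<^sub>C x = c *\<^sub>C (m \<rhd> x)"
  by transfer (auto simp: bounded_clinear_def)

lemma rmult_scaleC: "c *\<^sub>C x \<lhd> m = c *\<^sub>C (x \<lhd> m)"
  by transfer (auto simp: bounded_clinear_def)

lemma lmult_diff: "m \<rhd> (x - y) = m \<rhd> x - m \<rhd> y"
  by (simp add: bounded_linear_lmult bounded_linear.linear linear_diff)

lemma rmult_diff: "(x - y) \<lhd> m = x \<lhd> m - y \<lhd> m"
  using linear_diff[OF bounded_linear.linear[OF bounded_linear_rmult[of m]]] .

lemma lmult_add: "m \<rhd> (x + y) = m \<rhd> x + m \<rhd> y"
  by (simp add: bounded_linear_lmult bounded_linear.linear linear_add)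

lemma rmult_add: "(x + y) \<lhd> m = x \<lhd> m + y \<lhd> m"
  using linear_add[OF bounded_linear.linear[OF bounded_linear_rmult[of m]]] .

lemma multiplier_eqI_rmult:
  assumes "\<And>x. x \<lhd> m = x \<lhd> n"
  shows "m = n"
proof (rule multiplier_eqI)
  fix x
  have "z * (m \<rhd> x - n \<rhd> x) = 0" for z
    by (simp add: right_diff_distrib mult_lmult assms)
  from left_faithful[OF this] show "m \<rhd> x = n \<rhd> x" by simp
qed

lemma star_star_multiplier [simp]: "star (star m) = m" for m :: "'a::cstar_algebra multiplier"
  by (rule multiplier_eqI) (simp add: star_star)

lemma star_mult_multiplier: "star (m * n) = star n * star m" for m n :: "'a::cstar_algebra multiplier"
  by (rule multiplier_eqI) (simp add: star_star)

lemma star_rmult: "star (x \<lhd> m) = star m \<rhd> star x"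
  by (simp add: star_star)

lemma star_lmult: "star (m \<rhd> x) = star x \<lhd> star m"
  by (simp add: star_star)

lemma mult_rmult_assoc: "(x \<lhd> star m) * y = x * (star m \<rhd> y)"
  by (simp only: mult_lmult)

lemma unitary_one [simp]: "unitary 1"
  unfolding unitary_def by (auto intro!: multiplier_eqI simp: star_star)

lemma unitary_star: "unitary (star w)" if "unitary w"
  using that by (simp add: unitary_def)

lemma unitary_mult:
  assumes "unitary w" "unitary z"
  shows "unitary (w * z)"
proof -
  have "star (w * z) * (w * z) = star z * (star w * w) * z"
    "w * z * star (w * z) = w * (z * star z) * star w"
    by (simp_all only: star_mult_multiplier mult.assoc)
  then show ?thesis using assms by (simp add: unitary_def)
qed

lemma unitary_cancel:
  assumes "unitary w"
  shows "w \<rhd> star w \<rhd> x = x" "star w \<rhd> w \<rhd> x = x"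
    "x \<lhd> w \<lhd> star w = x" "x \<lhd> star w \<lhd> w = x"
proof -
  have "w * star w = 1" "star w * w = 1" using assms by (auto simp: unitary_def)
  then show "w \<rhd> star w \<rhd> x = x" "star w \<rhd> w \<rhd> x = x"
    "x \<lhd> w \<lhd> star w = x" "x \<lhd> star w \<lhd> w = x"
    by (metis lmult_simps(2,6) rmult_simps(2,6))+
qed

lemma norm_unitary_lmult: "norm (w \<rhd> x) = norm x" if "unitary w"
proof -
  have "star (w \<rhd> x) * (w \<rhd> x) = (star x \<lhd> star w) * (w \<rhd> x)"
    by (simp only: star_lmult)
  also have "\<dots> = star x * x"
    by (simp only: mult_rmult_assoc unitary_cancel[OF that])
  finally have "norm (star (w \<rhd> x) * (w \<rhd> x)) = norm (star x * x)" by simp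
  then show ?thesis unfolding cstar_identity by simp
qed

lemma norm_unitary_rmult: "norm (x \<lhd> w) = norm x" if "unitary w"
  using norm_unitary_lmult[OF unitary_star[OF that], of "star x"]
  by (metis norm_star star_rmult)

lemma nondegenerate_eqI:
  assumes \<phi>: "nondegenerate \<phi>" and f: "bounded_linear f" and g: "bounded_linear g"
    and eq: "\<And>a b. f (\<phi> a * b) = g (\<phi> a * b)"
  shows "f x = g x"
proof -
  let ?S = "{\<phi> a * b |a b. True}"
  have "f x - g x = 0"
  proof (rule continuous_constant_on_closure[where f = "\<lambda>y. f y - g y" and S = "span ?S"])
    show "f y - g y = 0" if "y \<in> span ?S" for y
      using linear_eq_on_span[OF bounded_linear.linear[OF f] bounded_linear.linear[OF g] _ that] eq
      by fastforce
    show "continuous_on (closure (span ?S)) (\<lambda>y. f y - g y)"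
      by (intro continuous_on_diff linear_continuous_on f g)
    show "x \<in> closure (span ?S)"
      using \<phi> by (simp add: nondegenerate_def)
  qed
  then show ?thesis by simp
qed

lemma nondegenerate_right_cancel:
  assumes "nondegenerate \<phi>" and "\<And>c. x * \<phi> c = y * \<phi> c"
  shows "x = y"
proof -
  have "x * z = y * z" for z
    by (rule nondegenerate_eqI[OF assms(1)])
      (simp_all add: bounded_linear_mult_right assms(2) flip: mult.assoc)
  then have "(x - y) * z = 0" for z by (simp add: left_diff_distrib)
  from right_faithful[OF this] show ?thesis by simp
qed

text \<open>
  The products in the target of a non-degenerate map have dense span, and a surjection onto
  that target reaches all of them.
\<close>

lemma nondegenerate_surj:
  fixes \<phi> :: "'a::cstar_algebra \<Rightarrow> 'b::cstar_algebra" and \<beta> :: "'c::cstar_algebra \<Rightarrow> 'b"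
  assumes "nondegenerate \<phi>" and "surj \<beta>"
  shows "nondegenerate \<beta>"
proof -
  have "{\<phi> a * b |a b. True} \<subseteq> {\<beta> a * b |a b. True}"
    using assms(2) by clarify (metis surjD)
  from closure_mono[OF span_mono[OF this]] show ?thesis
    using assms(1) unfolding nondegenerate_def by blast
qed

lemma subspace_closure:
  assumes S: "subspace S"
  shows "subspace (closure (S :: 'a::real_normed_vector set))"
  unfolding subspace_def
proof (intro conjI ballI allI)
  show "0 \<in> closure S" using closure_subset subspace_0[OF S] by blast
  fix x y c assume "x \<in> closure S" "y \<in> closure S"
  then obtain p q where "\<forall>n. p n \<in> S" "p \<longlonglongrightarrow> x" "\<forall>n. q n \<in> S" "q \<longlonglongrightarrow> y"
    unfolding closure_sequential by blast
  then have "\<forall>n. p n + q n \<in> S" "(\<lambda>n. p n + q n) \<longlonglongrightarrow> x + y"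
    "\<forall>n. c *\<^sub>R p n \<in> S" "(\<lambda>n. c *\<^sub>R p n) \<longlonglongrightarrow> c *\<^sub>R x"
    by (auto intro: subspace_add[OF S] subspace_scale[OF S] tendsto_intros)
  then show "x + y \<in> closure S" and "c *\<^sub>R x \<in> closure S"
    unfolding closure_sequential by (metis (no_types, lifting))+
qed

text \<open>
  For unitary \<open>w\<close> the assignment \<open>\<phi> a * b \<mapsto> \<phi> (w \<rhd> a) * b\<close> preserves the inner product
  \<open>star x * y\<close>, because \<open>star (w \<rhd> a) * (w \<rhd> c) = star a * c\<close>. It is therefore isometric on
  the span of the elements \<open>\<phi> a * b\<close>, which makes it well defined there and lets it extend to
  the closure. The proof takes the closure \<open>V\<close> of the linear span of its graph, and reads
  off \<open>L\<close> from \<open>V\<close>.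
\<close>

lemma mult_ext_exists_left:
  fixes \<phi> :: "'a::cstar_algebra \<Rightarrow> 'b::cstar_algebra"
  assumes \<phi>: "star_hom \<phi>" and nd: "nondegenerate \<phi>" and w: "unitary w"
  obtains L where "bounded_clinear L" "\<And>a b. L (\<phi> a * b) = \<phi> (w \<rhd> a) * b"
proof -
  define S where "S = {(\<phi> a * b, \<phi> (w \<rhd> a) * b) |a b. True}"
  define V where "V = closure (span S)"
  have sub: "subspace V"
    unfolding V_def by (simp add: subspace_closure)
  have "star (snd p) * snd q = star (fst p) * fst q" if "p \<in> span S" "q \<in> span S" for p q
  proof -
    have *: "star (snd p) * snd q = star (fst p) * fst q" if "p \<in> S" "q \<in> S" for p q
    proof -
      have "star (w \<rhd> a) * (w \<rhd> c) = star a * c" for a c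
        by (simp only: star_lmult mult_rmult_assoc unitary_cancel[OF w])
      then have "star (\<phi> (w \<rhd> a)) * \<phi> (w \<rhd> c) = star (\<phi> a) * \<phi> c" for a c
        by (metis star_homD(3,4)[OF \<phi>])
      then have "star (\<phi> (w \<rhd> a)) * (\<phi> (w \<rhd> c) * d) = star (\<phi> a) * (\<phi> c * d)" for a c d
        by (metis mult.assoc)
      then show ?thesis
        using that by (auto simp: S_def star_mult mult.assoc)
    qed
    have **: "star (snd p) * snd q = star (fst p) * fst q" if p: "p \<in> S" for p
      using \<open>q \<in> span S\<close>
      by (induction rule: span_induct_alt) (simp_all add: * p distrib_left)
    show ?thesis
      using \<open>p \<in> span S\<close>
      by (induction rule: span_induct_alt)
        (simp_all add: ** star_zero star_add star_scaleR distrib_right)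
  qed
  then have "norm (snd p) = norm (fst p)" if "p \<in> span S" for p
    using that cstar_identity by (metis norm_ge_zero power2_eq_imp_eq)
  then have iso: "norm (snd p) = norm (fst p)" if "p \<in> V" for p
  proof -
    have "norm (snd p) - norm (fst p) = 0"
      by (rule continuous_constant_on_closure[where f = "\<lambda>p. norm (snd p) - norm (fst p)" and S = "span S"])
        (use that \<open>\<And>p. p \<in> span S \<Longrightarrow> _\<close> in \<open>auto simp: V_def intro!: continuous_intros\<close>)
    then show ?thesis by simp
  qed
  have ex: "\<exists>y. (x, y) \<in> V" for x
  proof -
    have "fst ` span S = span (fst ` S)"
      by (rule linear_span_image[OF linear_fst, symmetric])
    also have "fst ` S = {\<phi> a * b |a b. True}"
      by (force simp: S_def image_iff)
    finally have "x \<in> closure (fst ` span S)"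
      using nd by (simp add: nondegenerate_def)
    then obtain q where q: "\<And>n. q n \<in> fst ` span S" "q \<longlonglongrightarrow> x"
      unfolding closure_sequential by blast
    then have "\<forall>n. \<exists>p. p \<in> span S \<and> q n = fst p" by blast
    then obtain p where "\<forall>n. p n \<in> span S \<and> q n = fst (p n)" by metis
    moreover from this have "q = (\<lambda>n. fst (p n))" by auto
    ultimately have p: "\<And>n. p n \<in> span S" "(\<lambda>n. fst (p n)) \<longlonglongrightarrow> x"
      using q(2) by simp_all
    have "dist (snd (p m)) (snd (p n)) = dist (fst (p m)) (fst (p n))" for m n
    proof -
      have "p m - p n \<in> V"
        using p(1) sub closure_subset[of "span S"] by (auto simp: V_def intro!: subspace_diff)
      from iso[OF this] show ?thesis by (simp add: dist_norm)
    qed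
    moreover have "Cauchy (\<lambda>n. fst (p n))" using p(2) by (rule LIMSEQ_imp_Cauchy)
    ultimately have "Cauchy (\<lambda>n. snd (p n))" unfolding Cauchy_def by simp
    then obtain y where "(\<lambda>n. snd (p n)) \<longlonglongrightarrow> y"
      by (meson Cauchy_convergent convergent_def)
    with p(2) have "p \<longlonglongrightarrow> (x, y)"
      using tendsto_Pair by fastforce
    then have "(x, y) \<in> V"
      unfolding V_def closure_sequential using p(1) by blast
    then show ?thesis ..
  qed
  define L where "L x = (SOME y. (x, y) \<in> V)" for x
  have LV: "(x, L x) \<in> V" for x
    unfolding L_def using ex by (rule someI_ex)
  have uniq: "y = L x" if "(x, y) \<in> V" for x y
    using iso[OF subspace_diff[OF sub that LV[of x]]] by simp
  have lin: "bounded_linear L"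
  proof (rule bounded_linear_intro[where K = 1])
    show "L (x + y) = L x + L y" for x y
      using subspace_add[OF sub LV[of x] LV[of y]] by (intro uniq[symmetric]) simp
    show "L (r *\<^sub>R x) = r *\<^sub>R L x" for r x
      using subspace_scale[OF sub LV[of x], of r] by (intro uniq[symmetric]) simp
    show "norm (L x) \<le> norm x * 1" for x
      using iso[OF LV] by simp
  qed
  have L: "L (\<phi> a * b) = \<phi> (w \<rhd> a) * b" for a b
    by (rule uniq[symmetric])
      (use closure_subset[of "span S"] span_base[of _ S] in \<open>force simp: V_def S_def\<close>)
  have "L (c *\<^sub>C x) = c *\<^sub>C L x" for c x
  proof (rule nondegenerate_eqI[OF nd, where f = "\<lambda>x. L (c *\<^sub>C x)"])
    show "bounded_linear (\<lambda>x. L (c *\<^sub>C x))" "bounded_linear (\<lambda>x. c *\<^sub>C L x)"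
      by (rule bounded_linear_compose[OF lin bounded_linear_scaleC],
          rule bounded_linear_compose[OF bounded_linear_scaleC lin])
    show "L (c *\<^sub>C (\<phi> a * b)) = c *\<^sub>C L (\<phi> a * b)" for a b
      by (simp add: L flip: mult_scaleC_right)
  qed
  with lin L that show ?thesis by (auto simp: bounded_clinear_def)
qed

text \<open>
  The right half of the multiplier is the adjoint of the left half that belongs to \<open>star w\<close>.
\<close>

lemma mult_ext_unitary_lmult:
  assumes \<phi>: "star_hom \<phi>" and nd: "nondegenerate \<phi>" and w: "unitary w"
  shows "mult_ext \<phi> w \<rhd> \<phi> a = \<phi> (w \<rhd> a)"
proof -
  obtain L where L: "bounded_clinear L" "\<And>a b. L (\<phi> a * b) = \<phi> (w \<rhd> a) * b"
    using mult_ext_exists_left[OF \<phi> nd w] by blast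
  obtain L' where L': "bounded_clinear L'" "\<And>a b. L' (\<phi> a * b) = \<phi> (star w \<rhd> a) * b"
    using mult_ext_exists_left[OF \<phi> nd unitary_star[OF w]] by blast
  define R where "R x = star (L' (star x))" for x
  have bl: "bounded_linear L" "bounded_linear L'"
    using L L' by (auto simp: bounded_clinear_def)
  note blm = bounded_linear_mult_right and blc = bl[THEN bounded_linear_compose[OF bounded_linear_mult_right]]
  have "star (L' x) * y = star x * L y" for x y
  proof -
    have "star (L' (\<phi> a * b)) * (\<phi> c * d) = star (\<phi> a * b) * L (\<phi> c * d)" for a b c d
    proof -
      have "star (star w \<rhd> a) * c = star a * (w \<rhd> c)"
        by (simp only: star_lmult star_star_multiplier mult_lmult)
      then have "star (\<phi> (star w \<rhd> a)) * \<phi> c = star (\<phi> a) * \<phi> (w \<rhd> c)"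
        by (metis star_homD(3,4)[OF \<phi>])
      then show ?thesis
        unfolding L L' star_mult by (metis mult.assoc)
    qed
    from nondegenerate_eqI[OF nd blm blc(1) this]
    have 1: "star (L' (\<phi> a * b)) * y = star (\<phi> a * b) * L y" for a b y .
    have "star (L y) * (\<phi> a * b) = star y * L' (\<phi> a * b)" for a b y
      using arg_cong[OF 1[of a b y], of star] by (simp add: star_mult star_star)
    from nondegenerate_eqI[OF nd blm blc(2) this]
    have "star (L y) * x = star y * L' x" .
    from arg_cong[OF this, of star] show ?thesis by (simp add: star_mult star_star)
  qed
  then have "x * L y = R x * y" for x y
    unfolding R_def by (metis star_star)
  moreover have "bounded_clinear R"
    unfolding R_def using L'(1) by (rule bounded_clinear_star)
  ultimately have "(L, R) \<in> {(L, R) |L R. bounded_clinear L \<and> bounded_clinear R \<and> (\<forall>x y. x * L y = R x * y)}"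
    using L(1) by simp
  then have n: "Abs_multiplier (L, R) \<rhd> x = L x" for x
    by (simp add: lmult.rep_eq Abs_multiplier_inverse)
  have "mult_ext \<phi> w = Abs_multiplier (L, R)"
    by (rule mult_ext_eqI[OF nd]) (simp add: n L)
  then have "mult_ext \<phi> w \<rhd> (\<phi> a * b) = \<phi> (w \<rhd> a) * b" for b
    by (simp only: n L)
  then have "(mult_ext \<phi> w \<rhd> \<phi> a - \<phi> (w \<rhd> a)) * b = 0" for b
    by (simp only: left_diff_distrib lmult_mult diff_self)
  from right_faithful[OF this] show ?thesis by simp
qed

lemma mult_ext_unitary_rmult:
  assumes \<phi>: "star_hom \<phi>" and nd: "nondegenerate \<phi>" and w: "unitary w"
  shows "\<phi> a \<lhd> mult_ext \<phi> w = \<phi> (a \<lhd> w)"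
proof (rule nondegenerate_right_cancel[OF nd])
  fix c
  have "(\<phi> a \<lhd> mult_ext \<phi> w) * \<phi> c = \<phi> (a * (w \<rhd> c))"
    by (simp add: mult_ext_unitary_lmult[OF assms] star_homD[OF \<phi>] flip: mult_lmult)
  then show "(\<phi> a \<lhd> mult_ext \<phi> w) * \<phi> c = \<phi> (a \<lhd> w) * \<phi> c"
    by (simp add: mult_lmult star_homD[OF \<phi>])
qed

lemma mult_ext_one: "mult_ext \<phi> 1 = 1" if "nondegenerate \<phi>"
  by (rule mult_ext_eqI[OF that]) simp

lemma mult_ext_mult:
  assumes \<phi>: "star_hom \<phi>" and nd: "nondegenerate \<phi>" and "unitary w" "unitary z"
  shows "mult_ext \<phi> (w * z) = mult_ext \<phi> w * mult_ext \<phi> z"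
  by (rule mult_ext_eqI[OF nd]) (simp add: mult_ext_unitary_lmult assms lmult_mult)

lemma mult_ext_star:
  assumes \<phi>: "star_hom \<phi>" and nd: "nondegenerate \<phi>" and "unitary w"
  shows "mult_ext \<phi> (star w) = star (mult_ext \<phi> w)"
proof (rule mult_ext_eqI[OF nd])
  fix a b
  have "star (mult_ext \<phi> w) \<rhd> \<phi> a = star (\<phi> (star a) \<lhd> mult_ext \<phi> w)"
    by (simp add: star_homD[OF \<phi>])
  also have "\<dots> = \<phi> (star w \<rhd> a)"
    by (simp add: mult_ext_unitary_rmult assms star_homD(4)[OF \<phi>, symmetric])
  finally show "star (mult_ext \<phi> w) \<rhd> (\<phi> a * b) = \<phi> (star w \<rhd> a) * b"
    by (simp only: lmult_mult)
qed

lemma unitary_mult_ext: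
  assumes \<phi>: "star_hom \<phi>" and nd: "nondegenerate \<phi>" and w: "unitary w"
  shows "unitary (mult_ext \<phi> w)"
proof -
  have "mult_ext \<phi> (star w * w) = 1" "mult_ext \<phi> (w * star w) = 1"
    using w by (simp_all add: unitary_def mult_ext_one[OF nd])
  then show ?thesis
    unfolding unitary_def using mult_ext_mult[OF \<phi> nd] mult_ext_star[OF \<phi> nd w] w unitary_star[OF w]
    by metis
qed


section \<open>Actions on multipliers\<close>

lemma continuous_on_Lipschitz_family:
  fixes T :: "'g::topological_space \<Rightarrow> 'a::metric_space \<Rightarrow> 'b::metric_space"
  assumes cont: "\<And>a. continuous_on S (\<lambda>g. T g a)"
    and lip: "\<And>g x y. dist (T g x) (T g y) \<le> dist x y"
    and f: "continuous_on S f"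
  shows "continuous_on S (\<lambda>g. T g (f g))"
  unfolding continuous_on_def
proof
  fix g0 assume "g0 \<in> S"
  show "((\<lambda>g. T g (f g)) \<longlongrightarrow> T g0 (f g0)) (at g0 within S)"
  proof (rule metric_tendsto_imp_tendsto)
    have "((\<lambda>g. dist (f g) (f g0) + dist (T g (f g0)) (T g0 (f g0))) \<longlongrightarrow>
        dist (f g0) (f g0) + dist (T g0 (f g0)) (T g0 (f g0))) (at g0 within S)"
      using f cont \<open>g0 \<in> S\<close> by (intro tendsto_intros) (auto simp: continuous_on_def)
    then show "((\<lambda>g. dist (f g) (f g0) + dist (T g (f g0)) (T g0 (f g0))) \<longlongrightarrow> 0) (at g0 within S)"
      by simp
    have "dist (T g (f g)) (T g0 (f g0)) \<le>
        dist (dist (f g) (f g0) + dist (T g (f g0)) (T g0 (f g0))) 0" for g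
      using dist_triangle[of "T g (f g)" "T g0 (f g0)" "T g (f g0)"] lip[of g "f g" "f g0"]
      by (simp add: dist_real_def)
    then show "\<forall>\<^sub>F g in at g0 within S. dist (T g (f g)) (T g0 (f g0)) \<le>
        dist (dist (f g) (f g0) + dist (T g (f g0)) (T g0 (f g0))) 0"
      by simp
  qed
qed

text \<open>
  The density of products makes each \<open>\<alpha> g\<close> non-degenerate, so that \<open>mult_ext (\<alpha> g)\<close> really
  extends \<open>\<alpha> g\<close> to the unitary multipliers. Below, the density is inherited from the given
  non-degenerate morphisms.
\<close>

locale dense_action =
  fixes \<alpha> :: "'g::topological_group_add \<Rightarrow> 'a::cstar_algebra \<Rightarrow> 'a"
  assumes action: "cstar_action \<alpha>"
    and products_dense: "nondegenerate (id :: 'a \<Rightarrow> 'a)"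
begin

lemma hom: "star_hom (\<alpha> g)"
  using action by (simp add: cstar_action_def)

lemma nondegenerate: "nondegenerate (\<alpha> g)"
  by (rule nondegenerate_surj[OF products_dense])
    (use action in \<open>simp add: cstar_action_def bij_is_surj\<close>)

lemma zero [simp]: "\<alpha> 0 x = x"
  using action by (simp add: cstar_action_def)

lemma add: "\<alpha> (g + h) x = \<alpha> g (\<alpha> h x)"
  using action by (simp add: cstar_action_def)

lemma cancel [simp]: "\<alpha> g (\<alpha> (- g) x) = x" "\<alpha> (- g) (\<alpha> g x) = x"
  using add[of g "- g" x] add[of "- g" g x] by auto

lemma dist_le: "dist (\<alpha> g x) (\<alpha> g y) \<le> dist x y"
  using star_hom_norm_le[OF hom] linear_diff[OF bounded_linear.linear[OF star_hom_bounded_linear[OF hom]]]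
  by (metis dist_norm)

lemma continuous:
  assumes "continuous_on UNIV f"
  shows "continuous_on UNIV (\<lambda>g. \<alpha> g (f g))" "continuous_on UNIV (\<lambda>g. \<alpha> (- g) (f g))"
proof -
  have cont: "continuous_on UNIV (\<lambda>g. \<alpha> g a)" for a
    using action by (simp add: cstar_action_def)
  show "continuous_on UNIV (\<lambda>g. \<alpha> g (f g))"
    by (rule continuous_on_Lipschitz_family[OF cont dist_le assms])
  have "continuous_on UNIV (\<lambda>g. \<alpha> (- g) a)" for a
    by (rule continuous_on_compose2[OF cont]) (auto intro: continuous_intros)
  then show "continuous_on UNIV (\<lambda>g. \<alpha> (- g) (f g))"
    by (rule continuous_on_Lipschitz_family[OF _ dist_le assms])
qed

lemma ext_lmult: "mult_ext (\<alpha> g) w \<rhd> \<alpha> g a = \<alpha> g (w \<rhd> a)" if "unitary w"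
  using mult_ext_unitary_lmult[OF hom nondegenerate that] .

lemma ext_rmult: "\<alpha> g a \<lhd> mult_ext (\<alpha> g) w = \<alpha> g (a \<lhd> w)" if "unitary w"
  using mult_ext_unitary_rmult[OF hom nondegenerate that] .

lemmas ext_mult = mult_ext_mult[OF hom nondegenerate]
lemmas ext_star = mult_ext_star[OF hom nondegenerate]
lemmas ext_unitary = unitary_mult_ext[OF hom nondegenerate]

lemma ext_zero: "mult_ext (\<alpha> 0) w = w" if "unitary w"
  by (rule multiplier_eqI) (use ext_lmult[OF that, of 0] in simp)

lemma ext_add: "mult_ext (\<alpha> (g + h)) w = mult_ext (\<alpha> g) (mult_ext (\<alpha> h) w)" if "unitary w"
  by (rule mult_ext_eqI[OF nondegenerate])
    (simp add: add ext_lmult lmult_mult that ext_unitary)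

end


section \<open>Cocycle morphisms as maps of Fell bundles\<close>

text \<open>
  In the semidirect product Fell bundle \<open>A \<times> G\<close> the fibres multiply by
  \<open>(x, g) (a, h) = (x * \<alpha> g a, g + h)\<close>. The conditions below say that
  \<open>(a, g) \<mapsto> (T g a, g)\<close> is a continuous morphism of such bundles. They are closed under
  pointwise limits, apart from the continuity in \<open>g\<close>, and they do not mention multipliers.
\<close>

definition bundle_hom ::
  "('g::topological_group_add \<Rightarrow> 'a::cstar_algebra \<Rightarrow> 'a) \<Rightarrow> ('g \<Rightarrow> 'b::cstar_algebra \<Rightarrow> 'b) \<Rightarrow>
   ('g \<Rightarrow> 'a \<Rightarrow> 'b) \<Rightarrow> bool" where
  "bundle_hom \<alpha> \<beta> T \<longleftrightarrow>
     (\<forall>g x y. T g (x + y) = T g x + T g y) \<and> (\<forall>g c x. T g (c *\<^sub>C x) = c *\<^sub>C T g x) \<and>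
     (\<forall>g h x a. T (g + h) (x * \<alpha> g a) = T g x * \<beta> g (T h a)) \<and>
     (\<forall>g x y. T g x * star (T g y) = T 0 (x * star y)) \<and>
     (\<forall>x. T 0 (star x) = star (T 0 x)) \<and>
     (\<forall>a. continuous_on UNIV (\<lambda>g. T g a))"

text \<open>
  The fibre maps \<open>a \<mapsto> \<phi>(a) u\<^sub>g\<close> of a cocycle morphism. In the composition
  \<open>(\<psi> \<circ> \<phi>, \<psi>(u) v)\<close> the fibre maps are simply composed.
\<close>

definition bundle_map ::
  "('a::cstar_algebra \<Rightarrow> 'b::cstar_algebra) \<Rightarrow> ('g \<Rightarrow> 'b multiplier) \<Rightarrow> 'g \<Rightarrow> 'a \<Rightarrow> 'b" where
  "bundle_map \<phi> u g a = \<phi> a \<lhd> u g"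

text \<open>
  The fibre maps of \<open>(Ad w \<circ> \<phi>, w u \<beta>(w)\<^sup>*)\<close> when \<open>T\<close> consists of those of \<open>(\<phi>, u)\<close>.
\<close>

definition bundle_conj ::
  "('g \<Rightarrow> 'b::cstar_algebra \<Rightarrow> 'b) \<Rightarrow> 'b multiplier \<Rightarrow> ('g \<Rightarrow> 'a \<Rightarrow> 'b) \<Rightarrow> 'g \<Rightarrow> 'a \<Rightarrow> 'b" where
  "bundle_conj \<beta> w T g a = (w \<rhd> T g a) \<lhd> star (mult_ext (\<beta> g) w)"

locale action_pair = A: dense_action \<alpha> + B: dense_action \<beta>
  for \<alpha> :: "'g::topological_group_add \<Rightarrow> 'a::cstar_algebra \<Rightarrow> 'a"
    and \<beta> :: "'g \<Rightarrow> 'b::cstar_algebra \<Rightarrow> 'b"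
begin

lemma bundle_homD:
  assumes "bundle_hom \<alpha> \<beta> T"
  shows "T g (x + y) = T g x + T g y" "T g (c *\<^sub>C x) = c *\<^sub>C T g x"
    "T (g + h) (x * \<alpha> g a) = T g x * \<beta> g (T h a)"
    "T g x * star (T g y) = T 0 (x * star y)"
    "T 0 (star x) = star (T 0 x)"
    "continuous_on UNIV (\<lambda>g. T g a)"
  using assms unfolding bundle_hom_def by blast+

lemma bundle_hom_star_hom: "star_hom (T 0)" if "bundle_hom \<alpha> \<beta> T"
  unfolding star_hom_def using bundle_homD[OF that] bundle_homD(3)[OF that, of 0 0] by simp

lemma bundle_hom_mult:
  assumes "bundle_hom \<alpha> \<beta> T"
  shows "T 0 x * T g y = T g (x * y)" "T g x * \<beta> g (T 0 y) = T g (x * \<alpha> g y)"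
  using bundle_homD(3)[OF assms, of 0 g] bundle_homD(3)[OF assms, of g 0] by simp_all

lemma bundle_hom_diff: "T g (x - y) = T g x - T g y" if "bundle_hom \<alpha> \<beta> T"
  using bundle_homD(1)[OF that, of g "x - y" y] by (simp add: algebra_simps)

text \<open>
  As \<open>T g x * star (T g x) = T 0 (x * star x)\<close>, contractivity of the *-homomorphism \<open>T 0\<close>
  passes to every fibre.
\<close>

lemma bundle_hom_norm_le:
  assumes T: "bundle_hom \<alpha> \<beta> T"
  shows "norm (T g x) \<le> norm x"
proof -
  have sq: "norm (y * star y) = (norm y)\<^sup>2" for y :: "'c::cstar_algebra"
    using cstar_identity[of "star y"] by (simp add: star_star norm_star)
  have "(norm (T g x))\<^sup>2 = norm (T 0 (x * star x))"
    by (simp add: bundle_homD(4)[OF T] flip: sq)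
  also have "\<dots> \<le> norm (x * star x)"
    by (rule star_hom_norm_le[OF bundle_hom_star_hom[OF T]])
  finally show ?thesis by (simp add: sq)
qed

lemma bundle_hom_dist_le: "dist (T g x) (T g y) \<le> dist x y" if "bundle_hom \<alpha> \<beta> T"
  using bundle_hom_norm_le[OF that, of g "x - y"] by (simp add: dist_norm bundle_hom_diff[OF that])

lemma bundle_hom_limit:
  assumes T: "\<And>n. bundle_hom \<alpha> \<beta> (T n)"
    and lim: "\<And>g a. (\<lambda>n. T n g a) \<longlonglongrightarrow> T' g a"
    and cont: "\<And>a. continuous_on UNIV (\<lambda>g. T' g a)"
  shows "bundle_hom \<alpha> \<beta> T'"
proof -
  have lim_star: "(\<lambda>n. star (T n g a)) \<longlonglongrightarrow> star (T' g a)" for g a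
    by (rule bounded_linear.tendsto[OF bounded_linear_star lim])
  have lim_beta: "(\<lambda>n. \<beta> h (T n g a)) \<longlonglongrightarrow> \<beta> h (T' g a)" for g a h
    by (rule bounded_linear.tendsto[OF star_hom_bounded_linear[OF B.hom] lim])
  have lim_scale: "(\<lambda>n. c *\<^sub>C T n g a) \<longlonglongrightarrow> c *\<^sub>C T' g a" for c g a
    by (rule bounded_linear.tendsto[OF bounded_linear_scaleC lim])
  show ?thesis
    unfolding bundle_hom_def
  proof (intro conjI allI cont)
    show "T' g (x + y) = T' g x + T' g y" for g x y
      by (rule LIMSEQ_unique[OF lim]) (simp only: bundle_homD(1)[OF T] tendsto_add[OF lim lim])
    show "T' g (c *\<^sub>C x) = c *\<^sub>C T' g x" for g c x
      by (rule LIMSEQ_unique[OF lim]) (simp only: bundle_homD(2)[OF T] lim_scale)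
    show "T' (g + h) (x * \<alpha> g a) = T' g x * \<beta> g (T' h a)" for g h x a
      by (rule LIMSEQ_unique[OF lim]) (simp only: bundle_homD(3)[OF T] tendsto_mult[OF lim lim_beta])
    show "T' g x * star (T' g y) = T' 0 (x * star y)" for g x y
      by (rule LIMSEQ_unique[OF tendsto_mult[OF lim lim_star]]) (simp only: bundle_homD(4)[OF T] lim)
    show "T' 0 (star x) = star (T' 0 x)" for x
      by (rule LIMSEQ_unique[OF lim]) (simp only: bundle_homD(5)[OF T] lim_star)
  qed
qed

lemma cocycle_morphismD:
  assumes "cocycle_morphism \<alpha> \<beta> (\<phi>, u)"
  shows "star_hom \<phi>" "unitary (u g)" "continuous_on UNIV (\<lambda>g. b \<lhd> u g)"
    "u (g + h) = u g * mult_ext (\<beta> g) (u h)" "u 0 = 1"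
    "\<phi> (\<alpha> g a) \<lhd> u g = u g \<rhd> \<beta> g (\<phi> a)"
proof -
  show "star_hom \<phi>" and u: "unitary (u g)" for g
    using assms by (auto simp: cocycle_morphism_def cocycle_def)
  show "continuous_on UNIV (\<lambda>g. b \<lhd> u g)"
    using assms by (auto simp: cocycle_morphism_def cocycle_def strictly_continuous_def)
  show coc: "u (g + h) = u g * mult_ext (\<beta> g) (u h)" for g h
    using assms by (auto simp: cocycle_morphism_def cocycle_def)
  have "u 0 = u 0 * u 0"
    using coc[of 0 0] by (simp add: B.ext_zero u)
  then have "star (u 0) * u 0 = star (u 0) * u 0 * u 0" by (simp add: mult.assoc)
  then show "u 0 = 1" using u[of 0] by (simp add: unitary_def)
  have "\<phi> (\<alpha> g a) = (u g \<rhd> \<beta> g (\<phi> a)) \<lhd> star (u g)"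
    using assms by (auto simp: cocycle_morphism_def Ad_def fun_eq_iff)
  then show "\<phi> (\<alpha> g a) \<lhd> u g = u g \<rhd> \<beta> g (\<phi> a)"
    by (simp only: unitary_cancel[OF u])
qed

lemma bundle_map_0: "bundle_map \<phi> u 0 = \<phi>" if "cocycle_morphism \<alpha> \<beta> (\<phi>, u)"
  by (simp add: fun_eq_iff bundle_map_def cocycle_morphismD(5)[OF that])

lemma bundle_hom_bundle_map:
  assumes X: "cocycle_morphism \<alpha> \<beta> (\<phi>, u)"
  shows "bundle_hom \<alpha> \<beta> (bundle_map \<phi> u)"
proof -
  note D = cocycle_morphismD[OF X]
  have "bundle_map \<phi> u (g + h) (x * \<alpha> g a) = bundle_map \<phi> u g x * \<beta> g (bundle_map \<phi> u h a)" for g h x a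
  proof -
    have "bundle_map \<phi> u (g + h) (x * \<alpha> g a) = \<phi> x * ((\<phi> (\<alpha> g a) \<lhd> u g) \<lhd> mult_ext (\<beta> g) (u h))"
      by (simp add: bundle_map_def D(4) star_homD(3)[OF D(1)] rmult_mult)
    also have "\<dots> = \<phi> x * (u g \<rhd> (\<beta> g (\<phi> a) \<lhd> mult_ext (\<beta> g) (u h)))"
      by (simp only: D(6) lmult_rmult)
    also have "\<dots> = bundle_map \<phi> u g x * \<beta> g (bundle_map \<phi> u h a)"
      by (simp only: mult_lmult B.ext_rmult[OF D(2)] bundle_map_def)
    finally show ?thesis .
  qed
  moreover have "bundle_map \<phi> u g x * star (bundle_map \<phi> u g y) = bundle_map \<phi> u 0 (x * star y)" for g x y
  proof -
    have "(\<phi> x \<lhd> u g) * star (\<phi> y \<lhd> u g) = \<phi> x * (u g \<rhd> star (u g) \<rhd> star (\<phi> y))"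
      by (simp only: star_rmult mult_lmult)
    then show ?thesis
      by (simp add: bundle_map_def D(5) unitary_cancel[OF D(2)] star_homD[OF D(1)] del: lmult_simps(7))
  qed
  ultimately show ?thesis
    unfolding bundle_hom_def
    by (auto simp: bundle_map_def star_homD[OF D(1)] rmult_add rmult_scaleC D(3,5))
qed

lemma bundle_hom_conj:
  assumes T: "bundle_hom \<alpha> \<beta> T" and w: "unitary w"
  shows "bundle_hom \<alpha> \<beta> (bundle_conj \<beta> w T)"
proof -
  note U = B.ext_unitary[OF w]
  have zero: "bundle_conj \<beta> w T 0 x = (w \<rhd> T 0 x) \<lhd> star w" for x
    by (simp add: bundle_conj_def B.ext_zero w)
  have "bundle_conj \<beta> w T (g + h) (x * \<alpha> g a) = bundle_conj \<beta> w T g x * \<beta> g (bundle_conj \<beta> w T h a)" for g h x a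
  proof -
    have "\<beta> g (bundle_conj \<beta> w T h a) = (mult_ext (\<beta> g) w \<rhd> \<beta> g (T h a)) \<lhd> star (mult_ext (\<beta> (g + h)) w)"
      unfolding bundle_conj_def B.ext_add[OF w] B.ext_star[OF U, symmetric] B.ext_star[OF w, symmetric]
      by (simp only: B.ext_lmult[OF w] B.ext_rmult[OF B.ext_unitary[OF unitary_star[OF w]]])
    then have "bundle_conj \<beta> w T g x * \<beta> g (bundle_conj \<beta> w T h a) =
        (((w \<rhd> T g x) \<lhd> star (mult_ext (\<beta> g) w)) * (mult_ext (\<beta> g) w \<rhd> \<beta> g (T h a)))
          \<lhd> star (mult_ext (\<beta> (g + h)) w)"
      by (simp only: bundle_conj_def rmult_mult)
    also have "\<dots> = bundle_conj \<beta> w T (g + h) (x * \<alpha> g a)"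
      by (simp only: mult_lmult unitary_cancel[OF U] bundle_conj_def bundle_homD(3)[OF T] lmult_mult)
    finally show ?thesis by simp
  qed
  moreover have "bundle_conj \<beta> w T g x * star (bundle_conj \<beta> w T g y) = bundle_conj \<beta> w T 0 (x * star y)" for g x y
  proof -
    have "bundle_conj \<beta> w T g x * star (bundle_conj \<beta> w T g y) =
        ((w \<rhd> T g x) \<lhd> star (mult_ext (\<beta> g) w)) * ((mult_ext (\<beta> g) w \<rhd> star (T g y)) \<lhd> star w)"
      by (simp only: bundle_conj_def star_rmult star_lmult star_star_multiplier lmult_rmult)
    also have "\<dots> = ((w \<rhd> T g x) * star (T g y)) \<lhd> star w"
      by (simp only: rmult_mult[symmetric] mult_lmult unitary_cancel[OF U])
    finally show ?thesis
      by (simp only: zero bundle_homD(4)[OF T] flip: lmult_mult)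
  qed
  moreover have "bundle_conj \<beta> w T 0 (star x) = star (bundle_conj \<beta> w T 0 x)" for x
    by (simp only: zero bundle_homD(5)[OF T] star_rmult star_lmult star_star_multiplier lmult_rmult)
  moreover have "continuous_on UNIV (\<lambda>g. bundle_conj \<beta> w T g a)" for a
  proof -
    \<comment> \<open>In this form the multiplier is independent of \<open>g\<close>.\<close>
    have "bundle_conj \<beta> w T g a = \<beta> g (\<beta> (- g) (w \<rhd> T g a) \<lhd> star w)" for g
      using B.ext_rmult[OF unitary_star[OF w], of g "\<beta> (- g) (w \<rhd> T g a)"]
      by (simp only: bundle_conj_def B.ext_star[OF w] B.cancel)
    moreover have "continuous_on UNIV (\<lambda>g. \<beta> g (\<beta> (- g) (w \<rhd> T g a) \<lhd> star w))"
      by (intro B.continuous bounded_linear.continuous_on[OF bounded_linear_rmult]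
          bounded_linear.continuous_on[OF bounded_linear_lmult] bundle_homD(6)[OF T])
    ultimately show ?thesis by simp
  qed
  ultimately show ?thesis
    unfolding bundle_hom_def
    by (simp add: bundle_conj_def bundle_homD(1,2)[OF T] lmult_add lmult_scaleC rmult_add rmult_scaleC
        del: rmult_simps(7))
qed

lemma bundle_map_lmult:
  assumes X: "cocycle_morphism \<alpha> \<beta> (\<phi>, u)" and nd: "nondegenerate \<phi>" and z: "unitary z"
  shows "bundle_map \<phi> u g (z \<rhd> a) = mult_ext \<phi> z \<rhd> bundle_map \<phi> u g a"
  by (simp only: bundle_map_def mult_ext_unitary_lmult[OF cocycle_morphismD(1)[OF X] nd z, symmetric] lmult_rmult)

text \<open>
  Multiplying on the right by \<open>\<beta> g (\<phi> c)\<close> turns multipliers into algebra elements, where the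
  multiplicativity of the bundle morphism applies; the elements \<open>\<beta> g (\<phi> c)\<close> cancel
  because \<open>\<phi>\<close> is non-degenerate.
\<close>

lemma bundle_map_rmult:
  assumes X: "cocycle_morphism \<alpha> \<beta> (\<phi>, u)" and nd: "nondegenerate \<phi>" and z: "unitary z"
  shows "bundle_map \<phi> u g (a \<lhd> mult_ext (\<alpha> g) z) = bundle_map \<phi> u g a \<lhd> mult_ext (\<beta> g) (mult_ext \<phi> z)"
    (is "?l = ?r")
proof -
  note T = bundle_hom_bundle_map[OF X]
  note Phi = cocycle_morphismD(1)[OF X]
  have "?r * \<beta> g (\<phi> c) = ?l * \<beta> g (\<phi> c)" for c
  proof -
    have "?r * \<beta> g (\<phi> c) = bundle_map \<phi> u g a * \<beta> g (bundle_map \<phi> u 0 (z \<rhd> c))"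
      by (simp only: mult_lmult[symmetric] B.ext_lmult unitary_mult_ext[OF Phi nd z]
          mult_ext_unitary_lmult[OF Phi nd z] bundle_map_0[OF X])
    also have "\<dots> = ?l * \<beta> g (bundle_map \<phi> u 0 c)"
      by (simp only: bundle_hom_mult[OF T] A.ext_lmult[OF z, symmetric] mult_lmult)
    finally show ?thesis by (simp only: bundle_map_0[OF X])
  qed
  then have "?r * \<beta> g (\<phi> c * d) = ?l * \<beta> g (\<phi> c * d)" for c d
    by (simp add: star_homD(3)[OF B.hom] flip: mult.assoc)
  note 1 = this
  have bl: "bounded_linear (\<lambda>d. y * \<beta> g d)" for y
    using bounded_linear_compose[OF bounded_linear_mult_right star_hom_bounded_linear[OF B.hom]] .
  have *: "?r * \<beta> g d = ?l * \<beta> g d" for d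
    by (rule nondegenerate_eqI[OF nd bl bl 1])
  have "(?r - ?l) * d = 0" for d
    using *[of "\<beta> (- g) d"] by (simp add: left_diff_distrib)
  from right_faithful[OF this] show ?thesis by simp
qed

text \<open>
  A unitary conjugation of the inner map can be moved outside. Hence the orbit of a
  composition under unitary conjugation depends only on the orbits of its two factors.
\<close>

lemma bundle_conj_bundle_map:
  assumes X: "cocycle_morphism \<alpha> \<beta> (\<phi>, u)" and nd: "nondegenerate \<phi>"
    and z: "unitary z" and w: "unitary w"
  shows "bundle_conj \<beta> w (bundle_map \<phi> u) g (bundle_conj \<alpha> z T g x) =
    bundle_conj \<beta> (w * mult_ext \<phi> z) (\<lambda>g x. bundle_map \<phi> u g (T g x)) g x"
proof -
  note Phi = cocycle_morphismD(1)[OF X]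
  have zz: "unitary (mult_ext \<phi> z)" by (rule unitary_mult_ext[OF Phi nd z])
  have "bundle_map \<phi> u g (bundle_conj \<alpha> z T g x) =
      (mult_ext \<phi> z \<rhd> bundle_map \<phi> u g (T g x)) \<lhd> star (mult_ext (\<beta> g) (mult_ext \<phi> z))"
    by (simp only: bundle_conj_def A.ext_star[OF z, symmetric]
        bundle_map_rmult[OF X nd unitary_star[OF z]] bundle_map_lmult[OF X nd z]
        mult_ext_star[OF Phi nd z] B.ext_star[OF zz])
  then show ?thesis
    by (simp only: bundle_conj_def B.ext_mult[OF w zz] star_mult_multiplier lmult_simps(6)
        rmult_simps(6) lmult_rmult)
qed

lemma bundle_map_comp:
  assumes "star_hom \<psi>" "nondegenerate \<psi>" "unitary (u g)"
  shows "bundle_map (\<psi> \<circ> \<phi>) (\<lambda>g. mult_ext \<psi> (u g) * v g) g a = bundle_map \<psi> v g (bundle_map \<phi> u g a)"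
  by (simp add: bundle_map_def mult_ext_unitary_rmult assms)

end


section \<open>Approximate intertwining\<close>

text \<open>
  By the Lindelof property, countably many open sets with compact supersets cover the space,
  and finitely many of them cover a given compact set; \<open>K n\<close> collects the first \<open>n + 1\<close> supersets.
\<close>

lemma locally_compact_exhaustion:
  assumes lc: "locally_compact_space (euclidean :: 'g::second_countable_topology topology)"
  obtains K :: "nat \<Rightarrow> 'g::second_countable_topology set" where "\<And>n. compact (K n)" "mono K"
    "\<And>C. compact C \<Longrightarrow> \<exists>n. C \<subseteq> K n"
proof -
  have "\<forall>x::'g. \<exists>U C. open U \<and> compact C \<and> x \<in> U \<and> U \<subseteq> C"
    using lc by (simp add: locally_compact_space_def)
  then obtain U C where U: "\<And>x::'g. open (U x) \<and> compact (C x) \<and> x \<in> U x \<and> U x \<subseteq> C x"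
    by metis
  obtain \<F> where \<F>: "\<F> \<subseteq> range U" "countable \<F>" "\<Union>\<F> = \<Union>(range U)"
    by (rule Lindelof[of "range U"]) (use U in auto)
  then have "\<Union>\<F> = UNIV" using U by blast
  define V where "V = from_nat_into \<F>"
  have V: "range V = \<F>"
    unfolding V_def using \<F>(2) \<open>\<Union>\<F> = UNIV\<close> by (intro range_from_nat_into) auto
  then have "\<forall>i. \<exists>x. V i = U x" using \<F>(1) by blast
  then obtain p where p: "\<And>i. V i = U (p i)" by metis
  define K where "K n = (\<Union>i\<le>n. C (p i))" for n
  show ?thesis
  proof (rule that[of K])
    show "compact (K n)" for n
      unfolding K_def using U by (intro compact_UN) auto
    show "mono K"
      unfolding K_def by (intro monoI UN_mono) auto
    show "\<exists>n. D \<subseteq> K n" if D: "compact D" for D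
    proof -
      have "D \<subseteq> (\<Union>i\<in>UNIV. V i)" using V \<open>\<Union>\<F> = UNIV\<close> by auto
      moreover have "open (V i)" for i using U p by simp
      ultimately obtain I where I: "finite I" "D \<subseteq> (\<Union>i\<in>I. V i)"
        using compactE_image[OF D, of UNIV V] by auto
      then obtain n where "I \<subseteq> {..n}" by (meson finite_nat_iff_bounded_le)
      moreover have "V i \<subseteq> C (p i)" for i using U p by metis
      ultimately have "D \<subseteq> K n"
        unfolding K_def by (intro order_trans[OF I(2)] UN_mono)
      then show ?thesis ..
    qed
  qed
qed

lemma separable_dense_sequence:
  assumes "separable_space (euclidean :: 'a::topological_space topology)"
  obtains a :: "nat \<Rightarrow> 'a::topological_space" where "closure (range a) = UNIV"
proof -
  obtain D :: "'a set" where D: "countable D" "closure D = UNIV"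
    using assms by (auto simp: separable_space_def)
  then have "D \<noteq> {}" by auto
  with D that[of "from_nat_into D"] show ?thesis by (simp add: range_from_nat_into)
qed

text \<open>
  By contractivity, a finite net of the compact set \<open>X\<close> controls all of \<open>X\<close>.
\<close>

lemma approx_inverse_on_compact:
  fixes f :: "'g \<Rightarrow> 'a::metric_space \<Rightarrow> 'b::metric_space" and \<S> :: "('g \<Rightarrow> 'b \<Rightarrow> 'a) set"
  assumes f: "\<And>g x y. dist (f g x) (f g y) \<le> dist x y"
    and s: "\<And>s g x y. s \<in> \<S> \<Longrightarrow> dist (s g x) (s g y) \<le> dist x y"
    and approx: "\<And>X \<epsilon>. finite X \<Longrightarrow> 0 < \<epsilon> \<Longrightarrow>
      \<exists>s\<in>\<S>. \<forall>x\<in>X. \<forall>g\<in>K. dist (s g (f g x)) x < \<epsilon>"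
    and X: "compact X" and "0 < \<epsilon>"
  shows "\<exists>s\<in>\<S>. \<forall>x\<in>X. \<forall>g\<in>K. dist (s g (f g x)) x < \<epsilon>"
proof -
  obtain N where N: "finite N" "X \<subseteq> (\<Union>x\<in>N. ball x (\<epsilon>/3))"
    using X \<open>0 < \<epsilon>\<close> unfolding compact_eq_totally_bounded by (meson divide_pos_pos zero_less_numeral)
  obtain t where t: "t \<in> \<S>" "\<And>x g. x \<in> N \<Longrightarrow> g \<in> K \<Longrightarrow> dist (t g (f g x)) x < \<epsilon>/3"
    using approx[OF N(1), of "\<epsilon>/3"] \<open>0 < \<epsilon>\<close> by auto
  have "dist (t g (f g x)) x < \<epsilon>" if "x \<in> X" "g \<in> K" for x g
  proof -
    obtain y where y: "y \<in> N" "dist y x < \<epsilon>/3" using N(2) \<open>x \<in> X\<close> by auto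
    have "dist (t g (f g x)) (t g (f g y)) \<le> dist y x"
      using order_trans[OF s[OF t(1)] f] by (simp add: dist_commute)
    then show ?thesis
      using y t(2)[OF y(1) \<open>g \<in> K\<close>] dist_triangle[of "t g (f g x)" x "t g (f g y)"]
        dist_triangle[of "t g (f g y)" x y] by linarith
  qed
  with t(1) show ?thesis by blast
qed

text \<open>
  The steps are summable on each \<open>a i\<close>, uniformly over \<open>K m\<close>, once \<open>n\<close> exceeds \<open>i\<close> and \<open>m\<close>;
  the common Lipschitz bound carries the Cauchy property over to the closure.
\<close>

lemma Lipschitz_uniformly_convergent_on:
  fixes f :: "nat \<Rightarrow> 'g \<Rightarrow> 'a::metric_space \<Rightarrow> 'b::complete_space"
  assumes lip: "\<And>n g x y. dist (f n g x) (f n g y) \<le> dist x y"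
    and a: "closure (range a) = UNIV" and K: "mono K"
    and step: "\<And>i n g. i \<le> n \<Longrightarrow> g \<in> K n \<Longrightarrow>
      dist (f (Suc n) g (a i)) (f n g (a i)) \<le> 2 * (1/2)^n"
  shows "uniformly_convergent_on (K m) (\<lambda>n g. f n g x)"
proof (rule Cauchy_uniformly_convergent, unfold uniformly_Cauchy_on_def, intro allI impI)
  have tail: "dist (f n g (a i)) (f N g (a i)) \<le> 4 * (1/2)^N - 4 * (1/2)^n"
    if "N \<le> n" "i \<le> N" "g \<in> K N" for n N i g
    using \<open>N \<le> n\<close>
  proof (induction rule: dec_induct)
    case (step k)
    have "g \<in> K k" using monoD[OF K step(1)] that by auto
    then have "dist (f (Suc k) g (a i)) (f k g (a i)) \<le> 2 * (1/2)^k"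
      using assms(4)[of i k g] step that by simp
    then show ?case
      using step dist_triangle[of "f (Suc k) g (a i)" "f N g (a i)" "f k g (a i)"] by simp
  qed simp
  fix e :: real assume "0 < e"
  have "x \<in> closure (range a)" using a by simp
  then obtain i where i: "dist (a i) x < e/8"
    unfolding closure_approachable using \<open>0 < e\<close> by (metis rangeE zero_less_divide_iff zero_less_numeral)
  obtain M0 where M0: "(1/2::real)^M0 < e/16"
    using real_arch_pow_inv[of "e/16" "1/2"] \<open>0 < e\<close> by auto
  define M where "M = max M0 (max i m)"
  have "(1/2::real)^M \<le> (1/2)^M0" unfolding M_def by (intro power_decreasing) auto
  then have M: "4 * (1/2::real)^M < e/4" using M0 by linarith
  have near: "dist (f n g x) (f M g (a i)) < e/2" if "n \<ge> M" "g \<in> K m" for n g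
  proof -
    have "K m \<subseteq> K M" by (rule monoD[OF K]) (simp add: M_def)
    with that have "g \<in> K M" by blast
    then have "dist (f n g (a i)) (f M g (a i)) \<le> 4 * (1/2)^M - 4 * (1/2)^n"
      using that by (intro tail) (auto simp: M_def)
    also have "\<dots> \<le> 4 * (1/2)^M" by simp
    finally show ?thesis
      using lip[of n g x "a i"] i M dist_triangle[of "f n g x" "f M g (a i)" "f n g (a i)"]
        dist_commute[of x "a i"] \<open>0 < e\<close> by linarith
  qed
  show "\<exists>M. \<forall>g\<in>K m. \<forall>k\<ge>M. \<forall>n\<ge>M. dist (f k g x) (f n g x) < e"
    using near by (intro exI[of _ M]) (blast intro: dist_triangle_half_l)
qed

lemma Lipschitz_limits_inverse:
  fixes f :: "nat \<Rightarrow> 'a::metric_space \<Rightarrow> 'b::metric_space" and s :: "nat \<Rightarrow> 'b \<Rightarrow> 'a"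
  assumes f: "\<And>n x y. dist (f n x) (f n y) \<le> dist x y" "\<And>x. (\<lambda>n. f n x) \<longlonglongrightarrow> f' x"
    and s: "\<And>n x y. dist (s n x) (s n y) \<le> dist x y" "\<And>x. (\<lambda>n. s n x) \<longlonglongrightarrow> s' x"
    and a: "closure (range a) = UNIV" and inv: "\<And>i. (\<lambda>n. s n (f n (a i))) \<longlonglongrightarrow> a i"
  shows "s' (f' x) = x"
proof -
  have f'_lip: "dist (f' x) (f' y) \<le> dist x y" for x y
    by (rule tendsto_le[OF _ tendsto_const tendsto_dist[OF f(2) f(2)]]) (auto simp: f(1))
  have s'_lip: "dist (s' x) (s' y) \<le> dist x y" for x y
    by (rule tendsto_le[OF _ tendsto_const tendsto_dist[OF s(2) s(2)]]) (auto simp: s(1))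
  have "s' (f' (a i)) = a i" for i
  proof (rule LIMSEQ_unique[OF _ inv])
    let ?d = "\<lambda>n. dist (f n (a i)) (f' (a i)) + dist (s n (f' (a i))) (s' (f' (a i)))"
    have "(\<lambda>n. dist (f n (a i)) (f' (a i))) \<longlonglongrightarrow> 0" "(\<lambda>n. dist (s n (f' (a i))) (s' (f' (a i)))) \<longlonglongrightarrow> 0"
      using f(2) s(2) by (simp_all only: tendsto_dist_iff[symmetric])
    from tendsto_add[OF this] have d: "?d \<longlonglongrightarrow> 0" by simp
    have "dist (s n (f n (a i))) (s' (f' (a i))) \<le> dist (?d n) 0" for n
      using dist_triangle[of "s n (f n (a i))" "s' (f' (a i))" "s n (f' (a i))"]
        s(1)[of n "f n (a i)" "f' (a i)"] by simp
    then show "(\<lambda>n. s n (f n (a i))) \<longlonglongrightarrow> s' (f' (a i))"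
      by (intro metric_tendsto_imp_tendsto[OF d] always_eventually allI)
  qed
  note fixed = this
  have "dist (s' (f' x)) (s' (f' y)) \<le> dist x y" for x y
    using f'_lip s'_lip order_trans by blast
  then have cont: "continuous_on UNIV (\<lambda>x. s' (f' x))"
    unfolding continuous_on_iff by (meson le_less_trans)
  have "dist (s' (f' x)) x = 0"
  proof (rule continuous_constant_on_closure[of "range a" "\<lambda>x. dist (s' (f' x)) x"])
    show "continuous_on (closure (range a)) (\<lambda>x. dist (s' (f' x)) x)"
      unfolding a by (intro continuous_on_dist cont continuous_on_id)
    show "dist (s' (f' y)) y = 0" if "y \<in> range a" for y
      using that fixed by auto
    show "x \<in> closure (range a)" unfolding a by simp
  qed
  then show ?thesis by simp
qed

text \<open>
  Elliott's two-sided intertwining, for families of contractions indexed by \<open>G\<close> and composed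
  fibrewise. If \<open>s\<close> is chosen with \<open>s \<circ> f \<approx> id\<close> and then \<open>f'\<close> with \<open>f' \<circ> s \<approx> id\<close>, then
  \<open>f' \<approx> f' \<circ> s \<circ> f \<approx> f\<close>. The first approximation holds at \<open>a\<close> whenever \<open>s \<circ> f\<close> nearly fixes
  \<open>a\<close>, whatever the contraction \<open>f'\<close> is; the second needs \<open>f' \<circ> s\<close> to nearly fix the points
  \<open>f g a\<close>, a compact set that is known before \<open>f'\<close> is chosen. The same holds with the
  roles exchanged, so alternating choices with errors \<open>(1/2)^n\<close> on growing finite parts of dense
  sequences and on growing compact subsets of \<open>G\<close> give two Cauchy sequences, whose limits are
  mutually inverse.
\<close>

theorem two_sided_approximate_intertwining:
  fixes \<F> :: "('g::second_countable_topology \<Rightarrow> 'a::complete_space \<Rightarrow> 'b::complete_space) set"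
    and \<S> :: "('g \<Rightarrow> 'b \<Rightarrow> 'a) set"
  assumes lc: "locally_compact_space (euclidean :: 'g topology)"
    and sep: "separable_space (euclidean :: 'a topology)" "separable_space (euclidean :: 'b topology)"
    and F: "\<And>f g x y. f \<in> \<F> \<Longrightarrow> dist (f g x) (f g y) \<le> dist x y"
      "\<And>f x. f \<in> \<F> \<Longrightarrow> continuous_on UNIV (\<lambda>g. f g x)" "\<F> \<noteq> {}"
    and S: "\<And>s g x y. s \<in> \<S> \<Longrightarrow> dist (s g x) (s g y) \<le> dist x y"
      "\<And>s x. s \<in> \<S> \<Longrightarrow> continuous_on UNIV (\<lambda>g. s g x)"
    and SF: "\<And>f X K \<epsilon>. f \<in> \<F> \<Longrightarrow> finite X \<Longrightarrow> compact K \<Longrightarrow> 0 < \<epsilon> \<Longrightarrow>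
      \<exists>s\<in>\<S>. \<forall>x\<in>X. \<forall>g\<in>K. dist (s g (f g x)) x < \<epsilon>"
    and FS: "\<And>s X K \<epsilon>. s \<in> \<S> \<Longrightarrow> finite X \<Longrightarrow> compact K \<Longrightarrow> 0 < \<epsilon> \<Longrightarrow>
      \<exists>f\<in>\<F>. \<forall>x\<in>X. \<forall>g\<in>K. dist (f g (s g x)) x < \<epsilon>"
  obtains f s f' s' where
    "\<And>n. f n \<in> \<F>" "\<And>K x. compact K \<Longrightarrow> uniform_limit K (\<lambda>n g. f n g x) (\<lambda>g. f' g x) sequentially"
    "\<And>n. s n \<in> \<S>" "\<And>K x. compact K \<Longrightarrow> uniform_limit K (\<lambda>n g. s n g x) (\<lambda>g. s' g x) sequentially"
    "\<And>g x. s' g (f' g x) = x" "\<And>g x. f' g (s' g x) = x"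
proof -
  obtain K :: "nat \<Rightarrow> 'g set" where K: "\<And>n. compact (K n)" "mono K"
    "\<And>C. compact C \<Longrightarrow> \<exists>n. C \<subseteq> K n"
    using locally_compact_exhaustion[OF lc] by blast
  obtain a :: "nat \<Rightarrow> 'a" where a: "closure (range a) = UNIV"
    using separable_dense_sequence[OF sep(1)] by blast
  obtain b :: "nat \<Rightarrow> 'b" where b: "closure (range b) = UNIV"
    using separable_dense_sequence[OF sep(2)] by blast
  have SF': "\<exists>s\<in>\<S>. \<forall>x\<in>X. \<forall>g\<in>C. dist (s g (f g x)) x < \<epsilon>"
    if "f \<in> \<F>" "compact C" "compact X" "0 < \<epsilon>" for f C X \<epsilon>
  proof (rule approx_inverse_on_compact[where f = f and \<S> = \<S> and K = C and X = X])
    show "\<exists>s\<in>\<S>. \<forall>x\<in>Y. \<forall>g\<in>C. dist (s g (f g x)) x < \<delta>" if "finite Y" "0 < \<delta>" for Y \<delta>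
      using SF[OF \<open>f \<in> \<F>\<close> that(1) \<open>compact C\<close> that(2)] .
  qed (use F(1) S(1) that in auto)
  have FS': "\<exists>f\<in>\<F>. \<forall>x\<in>X. \<forall>g\<in>C. dist (f g (s g x)) x < \<epsilon>"
    if "s \<in> \<S>" "compact C" "compact X" "0 < \<epsilon>" for s C X \<epsilon>
  proof (rule approx_inverse_on_compact[where f = s and \<S> = \<F> and K = C and X = X])
    show "\<exists>f\<in>\<F>. \<forall>x\<in>Y. \<forall>g\<in>C. dist (f g (s g x)) x < \<delta>" if "finite Y" "0 < \<delta>" for Y \<delta>
      using FS[OF \<open>s \<in> \<S>\<close> that(1) \<open>compact C\<close> that(2)] .
  qed (use F(1) S(1) that in auto)
  define P where "P n = (\<lambda>(f, s). f \<in> \<F> \<and> s \<in> \<S> \<and>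
    (\<forall>i\<le>n. \<forall>g\<in>K n. dist (s g (f g (a i))) (a i) < (1/2)^n))" for n
  define Q where "Q n = (\<lambda>(f :: 'g \<Rightarrow> 'a \<Rightarrow> 'b, s :: 'g \<Rightarrow> 'b \<Rightarrow> 'a) (f' :: 'g \<Rightarrow> 'a \<Rightarrow> 'b, s' :: 'g \<Rightarrow> 'b \<Rightarrow> 'a).
    (\<forall>i\<le>n. \<forall>g\<in>K n. dist (f' g (s g (b i))) (b i) < (1/2)^n) \<and>
    (\<forall>i\<le>n. \<forall>g\<in>K n. dist (f' g (s g (f g (a i)))) (f g (a i)) < (1/2)^n) \<and>
    (\<forall>i\<le>n. \<forall>g\<in>K n. dist (s' g (f' g (s g (b i)))) (s g (b i)) < (1/2)^n))" for n
  have orbit_compact: "compact (\<Union>i\<le>n. (\<lambda>g. h g (c i)) ` K n)"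
    if "\<And>x. continuous_on UNIV (\<lambda>g. h g x)"
    for h :: "'g \<Rightarrow> 'c \<Rightarrow> 'd::metric_space" and c n
    using that K(1) by (intro compact_UN finite_atMost compact_continuous_image)
      (auto intro: continuous_on_subset)
  have init: "\<exists>p. P 0 p"
  proof -
    obtain f where f: "f \<in> \<F>" using F(3) by blast
    obtain s where "s \<in> \<S>" "\<forall>x\<in>{a 0}. \<forall>g\<in>K 0. dist (s g (f g x)) x < 1"
      using SF[OF f, of "{a 0}" "K 0" 1] K(1) by auto
    then have "P 0 (f, s)" using f by (simp add: P_def)
    then show ?thesis ..
  qed
  have step: "\<exists>q. P (Suc n) q \<and> Q n p q" if Pp: "P n p" for p n
  proof -
    obtain f s where p: "p = (f, s)" "f \<in> \<F>" "s \<in> \<S>"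
      using Pp by (cases p) (auto simp: P_def)
    \<comment> \<open>The orbit of the \<open>a i\<close> under \<open>f\<close> makes \<open>f'\<close> close to \<open>f\<close>; below, that of the
      \<open>b i\<close> under \<open>s\<close> makes \<open>s'\<close> close to \<open>s\<close>.\<close>
    let ?Y = "b ` {..n} \<union> (\<Union>i\<le>n. (\<lambda>g. f g (a i)) ` K n)"
    have "compact ?Y"
      by (rule compact_Un[OF finite_imp_compact orbit_compact[OF F(2)[OF p(2)]]]) simp
    then obtain f' where f': "f' \<in> \<F>" "\<And>y g. y \<in> ?Y \<Longrightarrow> g \<in> K n \<Longrightarrow> dist (f' g (s g y)) y < (1/2)^n"
      using FS'[OF p(3) K(1), of ?Y "(1/2)^n" n] by auto
    let ?X = "a ` {..Suc n} \<union> (\<Union>i\<le>n. (\<lambda>g. s g (b i)) ` K n)"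
    have "compact ?X"
      by (rule compact_Un[OF finite_imp_compact orbit_compact[OF S(2)[OF p(3)]]]) simp
    then obtain s' where s': "s' \<in> \<S>"
      "\<And>x g. x \<in> ?X \<Longrightarrow> g \<in> K (Suc n) \<Longrightarrow> dist (s' g (f' g x)) x < (1/2)^(Suc n)"
      using SF'[OF f'(1) K(1), of ?X "(1/2)^(Suc n)" "Suc n"] by auto
    have "K n \<subseteq> K (Suc n)" using K(2) by (simp add: monoD)
    moreover have "(1/2::real)^Suc n < (1/2)^n" by simp
    ultimately have s'_n: "dist (s' g (f' g x)) x < (1/2)^n" if "x \<in> ?X" "g \<in> K n" for x g
      using s'(2)[OF that(1), of g] that(2) by (meson less_trans subsetD)
    have "Q n p (f', s')"
      unfolding Q_def p(1) prod.case by (intro conjI allI impI ballI f'(2) s'_n) auto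
    moreover have "P (Suc n) (f', s')"
      using f'(1) s' by (auto simp: P_def)
    ultimately show ?thesis by blast
  qed
  obtain p where p: "\<And>n. P n (p n)" "\<And>n. Q n (p n) (p (Suc n))"
    using dependent_nat_choice[of P Q, OF init step] by blast
  define f where "f n = fst (p n)" for n
  define s where "s n = snd (p n)" for n
  have fF: "f n \<in> \<F>" and sS: "s n \<in> \<S>" for n
    using p(1)[of n] by (auto simp: P_def f_def s_def split: prod.splits)
  have sf: "dist (s n g (f n g (a i))) (a i) < (1/2)^n" if "i \<le> n" "g \<in> K n" for i n g
    using p(1)[of n] that by (auto simp: P_def f_def s_def split: prod.splits)
  have fs: "dist (f (Suc n) g (s n g (b i))) (b i) < (1/2)^n"
    and fsf: "dist (f (Suc n) g (s n g (f n g (a i)))) (f n g (a i)) < (1/2)^n"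
    and sfs: "dist (s (Suc n) g (f (Suc n) g (s n g (b i)))) (s n g (b i)) < (1/2)^n"
    if "i \<le> n" "g \<in> K n" for i n g
    using p(2)[of n] that by (auto simp: Q_def f_def s_def split: prod.splits)
  have "dist (f (Suc n) g (a i)) (f n g (a i)) \<le> 2 * (1/2)^n" if "i \<le> n" "g \<in> K n" for i n g
    using F(1)[OF fF, of "Suc n" g "a i" "s n g (f n g (a i))"] sf[OF that] fsf[OF that]
      dist_triangle[of "f (Suc n) g (a i)" "f n g (a i)" "f (Suc n) g (s n g (f n g (a i)))"]
    by (simp add: dist_commute)
  note f_conv = Lipschitz_uniformly_convergent_on[where f = f, OF F(1)[OF fF] a K(2) this]
  have "dist (s (Suc n) g (b i)) (s n g (b i)) \<le> 2 * (1/2)^n" if "i \<le> n" "g \<in> K n" for i n g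
    using S(1)[OF sS, of "Suc n" g "b i" "f (Suc n) g (s n g (b i))"] fs[OF that] sfs[OF that]
      dist_triangle[of "s (Suc n) g (b i)" "s n g (b i)" "s (Suc n) g (f (Suc n) g (s n g (b i)))"]
    by (simp add: dist_commute)
  note s_conv = Lipschitz_uniformly_convergent_on[where f = s, OF S(1)[OF sS] b K(2) this]
  define f' where "f' g x = lim (\<lambda>n. f n g x)" for g x
  define s' where "s' g x = lim (\<lambda>n. s n g x)" for g x
  have f_lim: "uniform_limit C (\<lambda>n g. f n g x) (\<lambda>g. f' g x) sequentially" if C: "compact C" for C x
  proof -
    obtain m where "C \<subseteq> K m" using K(3)[OF C] ..
    moreover have "uniform_limit (K m) (\<lambda>n g. f n g x) (\<lambda>g. f' g x) sequentially"
      using f_conv[of m x] unfolding f'_def uniformly_convergent_uniform_limit_iff .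
    ultimately show ?thesis by (rule uniform_limit_on_subset[rotated])
  qed
  have s_lim: "uniform_limit C (\<lambda>n g. s n g x) (\<lambda>g. s' g x) sequentially" if C: "compact C" for C x
  proof -
    obtain m where "C \<subseteq> K m" using K(3)[OF C] ..
    moreover have "uniform_limit (K m) (\<lambda>n g. s n g x) (\<lambda>g. s' g x) sequentially"
      using s_conv[of m x] unfolding s'_def uniformly_convergent_uniform_limit_iff .
    ultimately show ?thesis by (rule uniform_limit_on_subset[rotated])
  qed
  have f_pt: "(\<lambda>n. f n g x) \<longlonglongrightarrow> f' g x" and s_pt: "(\<lambda>n. s n g y) \<longlonglongrightarrow> s' g y" for g x y
    using tendsto_uniform_limitI[OF f_lim[of "{g}"]] tendsto_uniform_limitI[OF s_lim[of "{g}"]] by auto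
  have to_zero: "z \<longlonglongrightarrow> l" if z: "\<And>n. i \<le> n \<Longrightarrow> g \<in> K n \<Longrightarrow> dist (z n) l < (1/2)^n"
    for z :: "nat \<Rightarrow> 'c::metric_space" and l i g
  proof -
    obtain m where m: "{g} \<subseteq> K m" using K(3)[of "{g}"] by auto
    have "dist (z n) l \<le> (1/2)^n" if "n \<ge> max i m" for n
    proof -
      have "K m \<subseteq> K n" using K(2) that by (simp add: monoD)
      with m that have "dist (z n) l < (1/2)^n" by (intro z) auto
      then show ?thesis by simp
    qed
    then have "\<forall>\<^sub>F n in sequentially. dist (z n) l \<le> dist ((1/2::real)^n) 0"
      unfolding eventually_sequentially by (intro exI[of _ "max i m"]) simp
    moreover have "(\<lambda>n. (1/2::real)^n) \<longlonglongrightarrow> 0" by (intro LIMSEQ_power_zero) simp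
    ultimately show ?thesis by (rule metric_tendsto_imp_tendsto[rotated])
  qed
  show ?thesis
  proof (rule that[OF fF f_lim sS s_lim])
    show "s' g (f' g x) = x" for g x
      by (rule Lipschitz_limits_inverse[OF F(1)[OF fF] f_pt S(1)[OF sS] s_pt a to_zero[OF sf]])
    \<comment> \<open>In round \<open>n\<close> the approximate inverse of \<open>s n\<close> is \<open>f (Suc n)\<close>, hence the shift.\<close>
    show "f' g (s' g x) = x" for g x
      by (rule Lipschitz_limits_inverse[OF S(1)[OF sS] s_pt F(1)[OF fF] LIMSEQ_Suc[OF f_pt] b to_zero[OF fs]])
  qed auto
qed

lemma continuous_on_locally_uniform_limit:
  fixes h :: "nat \<Rightarrow> 'g::t2_space \<Rightarrow> 'a::metric_space"
  assumes lc: "locally_compact_space (euclidean :: 'g topology)"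
    and cont: "\<And>n. continuous_on UNIV (h n)"
    and lim: "\<And>K. compact K \<Longrightarrow> uniform_limit K h h' sequentially"
  shows "continuous_on UNIV h'"
proof (rule continuous_at_imp_continuous_on, rule ballI)
  fix x :: 'g
  have "\<exists>V K. open V \<and> compact K \<and> x \<in> V \<and> V \<subseteq> K"
    using lc by (simp add: locally_compact_space_def)
  then obtain V K where V: "open V" "compact K" "x \<in> V" "V \<subseteq> K" by blast
  have "continuous_on K h'"
    by (rule uniform_limit_theorem[OF _ lim[OF V(2)]])
      (auto intro: always_eventually continuous_on_subset[OF cont])
  with V show "isCont h' x"
    by (meson continuous_on_eq_continuous_at continuous_on_subset)
qed


section \<open>Invertible bundle morphisms are cocycle conjugacies\<close>

text \<open>
  If \<open>T g\<close> is to be \<open>\<Phi>(\<cdot>) u\<^sub>g\<close> with \<open>\<Phi> = T 0\<close> invertible, the right half of the multiplier \<open>u\<^sub>g\<close>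
  must be \<open>y \<mapsto> T g (\<Phi>\<inverse> y)\<close>, and equivariance \<open>u\<^sub>g \<beta>\<^sub>g(\<Phi> a) = \<Phi>(\<alpha>\<^sub>g a) u\<^sub>g\<close> forces the left half. The
  bundle identities for \<open>T\<close> give that these halves form a double centralizer and that
  the resulting \<open>u\<close> is a cocycle. The relation \<open>u u\<^sup>* = 1\<close> comes from
  \<open>T g x * star (T g y) = T 0 (x * star y)\<close>, and \<open>u\<^sup>* u = 1\<close> then from the surjectivity of \<open>T g\<close>.
\<close>

lemma (in action_pair) bundle_iso_cocycle:
  assumes T: "bundle_hom \<alpha> \<beta> T" and S: "bundle_hom \<beta> \<alpha> S"
    and ST: "\<And>g x. S g (T g x) = x" and TS: "\<And>g y. T g (S g y) = y"
  obtains U where "cocycle_morphism \<alpha> \<beta> (T 0, U)" "bundle_map (T 0) U = T"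
proof -
  interpret BA: action_pair \<beta> \<alpha> ..
  have scale: "\<beta> g (c *\<^sub>C y) = c *\<^sub>C \<beta> g y" "\<alpha> g (c *\<^sub>C x) = c *\<^sub>C \<alpha> g x" for g c x y
    by (rule star_homD(2)[OF B.hom], rule star_homD(2)[OF A.hom])
  have T_lin: "bounded_linear (T g)" for g
    using bundle_homD(1,2)[OF T] bundle_hom_norm_le[OF T]
    by (intro bounded_linear_intro[where K = 1]) (simp_all add: scaleR_scaleC)
  define L where "L g y = T g (\<alpha> g (S 0 (\<beta> (- g) y)))" for g y
  define R where "R g y = T g (S 0 y)" for g y
  have "bounded_clinear (L g)" for g
    unfolding L_def bounded_clinear_def
    by (auto simp: scale bundle_homD(2)[OF T] BA.bundle_homD(2)[OF S]
        intro!: bounded_linear_compose[OF T_lin] bounded_linear_compose[OF star_hom_bounded_linear[OF A.hom]]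
          bounded_linear_compose[OF star_hom_bounded_linear[OF BA.bundle_hom_star_hom[OF S]]]
          star_hom_bounded_linear[OF B.hom])
  moreover have "bounded_clinear (R g)" for g
    unfolding R_def bounded_clinear_def
    by (auto simp: bundle_homD(2)[OF T] BA.bundle_homD(2)[OF S]
        intro!: bounded_linear_compose[OF T_lin] star_hom_bounded_linear[OF BA.bundle_hom_star_hom[OF S]])
  moreover have "x * L g y = R g x * y" for g x y
  proof -
    have "x * L g y = T 0 (S 0 x) * T g (\<alpha> g (S 0 (\<beta> (- g) y)))" by (simp add: TS L_def)
    also have "\<dots> = T g (S 0 x) * \<beta> g (T 0 (S 0 (\<beta> (- g) y)))"
      by (simp only: bundle_hom_mult[OF T])
    finally show ?thesis by (simp add: TS R_def)
  qed
  ultimately have mem: "(L g, R g) \<in> {(L, R) |L R. bounded_clinear L \<and> bounded_clinear R \<and> (\<forall>x y. x * L y = R x * y)}" for g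
    by simp
  define U where "U g = Abs_multiplier (L g, R g)" for g
  have UL: "U g \<rhd> y = L g y" and UR: "y \<lhd> U g = R g y" for g y
    using Abs_multiplier_inverse[OF mem] by (simp_all add: U_def lmult.rep_eq rmult.rep_eq)
  have T_right: "T 0 x \<lhd> U g = T g x" for g x
    by (simp add: UR R_def ST)
  have T_left: "U g \<rhd> \<beta> g (T h a) = T (g + h) (\<alpha> g a)" for g h a
  proof -
    have "y * (U g \<rhd> \<beta> g (T h a) - T (g + h) (\<alpha> g a)) = 0" for y
    proof -
      have "T 0 x * (U g \<rhd> \<beta> g (T h a)) = T 0 x * T (g + h) (\<alpha> g a)" for x
        by (simp only: mult_lmult T_right bundle_homD(3)[OF T, symmetric] bundle_hom_mult(1)[OF T])
      from this[of "S 0 y"] show ?thesis by (simp add: TS right_diff_distrib)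
    qed
    from left_faithful[OF this] show ?thesis by simp
  qed
  have "y \<lhd> U g \<lhd> star (U g) = y" for g y
  proof -
    have "((y \<lhd> U g) \<lhd> star (U g)) * z = y * z" for z
    proof -
      have "((T 0 x \<lhd> U g) \<lhd> star (U g)) * star (T 0 c) = T 0 x * star (T 0 c)" for x c
        by (simp only: mult_rmult_assoc star_rmult[symmetric] T_right bundle_homD(4)[OF T])
      from this[of "S 0 y" "S 0 (star z)"] show ?thesis by (simp only: TS star_star)
    qed
    then have "((y \<lhd> U g) \<lhd> star (U g) - y) * z = 0" for z by (simp only: left_diff_distrib diff_self)
    from right_faithful[OF this] show ?thesis by simp
  qed
  note UU = this
  have "y \<lhd> star (U g) \<lhd> U g = y" for g y
    using UU[of "T 0 (S g y)" g] by (simp only: T_right TS)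
  with UU have U: "unitary (U g)" for g
    unfolding unitary_def by (auto intro!: multiplier_eqI_rmult simp del: rmult_simps(7))
  have "strictly_continuous U"
  proof -
    have "continuous_on UNIV (\<lambda>g. L g y)" for y
      unfolding L_def
      by (intro continuous_on_Lipschitz_family[OF bundle_homD(6)[OF T] bundle_hom_dist_le[OF T]] A.continuous
          bounded_linear.continuous_on[OF star_hom_bounded_linear[OF BA.bundle_hom_star_hom[OF S]]]
          B.continuous continuous_on_const)
    then show ?thesis
      by (simp add: strictly_continuous_def UL UR R_def bundle_homD(6)[OF T])
  qed
  moreover have "U (g + h) = U g * mult_ext (\<beta> g) (U h)" for g h
  proof (rule multiplier_eqI)
    fix y
    define a where "a = S 0 (\<beta> (- (g + h)) y)"
    have y: "y = \<beta> (g + h) (T 0 a)" by (simp add: a_def TS del: minus_add_distrib)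
    have "U (g + h) \<rhd> y = T (g + h) (\<alpha> (g + h) a)"
      using T_left[of "g + h" 0 a] by (simp add: y)
    also have "\<dots> = U g \<rhd> \<beta> g (U h \<rhd> \<beta> h (T 0 a))"
      using T_left[of h 0 a] by (simp add: T_left A.add)
    finally show "U (g + h) \<rhd> y = (U g * mult_ext (\<beta> g) (U h)) \<rhd> y"
      by (simp add: y B.add B.ext_lmult[OF U])
  qed
  moreover have "Ad (U g) (\<beta> g (T 0 a)) = T 0 (\<alpha> g a)" for g a
    using T_left[of g 0 a] UU[of "T 0 (\<alpha> g a)" g] by (simp only: Ad_def T_right add_0_right)
  ultimately have "cocycle_morphism \<alpha> \<beta> (T 0, U)"
    using U bundle_hom_star_hom[OF T] by (auto simp: cocycle_morphism_def cocycle_def)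
  moreover have "bundle_map (T 0) U = T"
    by (simp add: fun_eq_iff bundle_map_def T_right)
  ultimately show ?thesis by (rule that)
qed

text \<open>
  The identity of fibre maps \<open>\<Psi>(\<Phi>(x) U\<^sub>g) V\<^sub>g = x\<close> reads \<open>x \<Psi>(U\<^sub>g) V\<^sub>g = x\<close>, so \<open>V\<^sub>g\<close> is the inverse
  of the unitary \<open>\<Psi>(U\<^sub>g)\<close>.
\<close>

lemma (in action_pair) cocycle_inverse_eqI:
  assumes X: "cocycle_morphism \<alpha> \<beta> (\<Phi>, U)" and Y: "cocycle_morphism \<beta> \<alpha> (\<Psi>, V)"
    and inv1: "\<And>g x. bundle_map \<Psi> V g (bundle_map \<Phi> U g x) = x"
    and inv2: "\<And>g y. bundle_map \<Phi> U g (bundle_map \<Psi> V g y) = y"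
  shows "bij \<Phi>" "(\<Psi>, V) = cocycle_inverse (\<Phi>, U)"
proof -
  interpret BA: action_pair \<beta> \<alpha> ..
  have 1: "\<Psi> (\<Phi> x) = x" "\<Phi> (\<Psi> y) = y" for x y
    using inv1[of 0 x] inv2[of 0 y] by (simp_all add: bundle_map_0[OF X] BA.bundle_map_0[OF Y])
  then show "bij \<Phi>" by (metis bijI')
  have inv: "inv \<Phi> = \<Psi>" using 1 by (metis inv_equality ext)
  have "surj \<Psi>" using 1 by (metis surjI)
  then have nd: "nondegenerate \<Psi>" by (rule nondegenerate_surj[OF A.products_dense])
  note Psi = cocycle_morphismD(1)[OF X] BA.cocycle_morphismD(1)[OF Y]
  have "V g = star (mult_ext \<Psi> (U g))" for g
  proof -
    let ?m = "mult_ext \<Psi> (U g)"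
    have m: "unitary ?m" by (rule unitary_mult_ext[OF Psi(2) nd cocycle_morphismD(2)[OF X]])
    have "x \<lhd> ?m \<lhd> V g = x" for x
    proof -
      have "x \<lhd> ?m = \<Psi> (\<Phi> x \<lhd> U g)"
        using mult_ext_unitary_rmult[OF Psi(2) nd cocycle_morphismD(2)[OF X], of "\<Phi> x"] by (simp add: 1)
      then show ?thesis using inv1[of g x] by (simp add: bundle_map_def)
    qed
    then have "x \<lhd> star ?m \<lhd> ?m \<lhd> V g = x \<lhd> star ?m" for x by blast
    then show ?thesis
      unfolding unitary_cancel[OF m] by (rule multiplier_eqI_rmult)
  qed
  then show "(\<Psi>, V) = cocycle_inverse (\<Phi>, U)"
    by (simp add: cocycle_inverse_def inv fun_eq_iff)
qed


section \<open>Approximate unitary equivalence\<close>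

text \<open>
  Approximate innerness provides unitaries that move the identity close to \<open>(\<theta>, c)\<close>; their
  adjoints move \<open>(\<theta>, c)\<close> back to the identity. Testing the cocycles against \<open>b = \<theta> x\<close> combines
  both convergences into convergence of the fibre maps, uniformly over compact sets.
\<close>

lemma (in dense_action) approx_inner_bundle_map:
  assumes inner: "approx_inner \<alpha> (\<theta>, c)" and X: "finite X" and K: "compact K" and "0 < \<epsilon>"
  obtains w where "unitary w" "\<And>x g. x \<in> X \<Longrightarrow> g \<in> K \<Longrightarrow> dist (bundle_conj \<alpha> w (bundle_map \<theta> c) g x) x < \<epsilon>"
proof -
  obtain F where F: "F \<noteq> bot" "eventually unitary F" "\<And>a. ((\<lambda>w. Ad w a) \<longlongrightarrow> \<theta> a) F"
    "\<And>b. uniform_limit K (\<lambda>w g. b \<lhd> (c g - w * star (mult_ext (\<alpha> g) w))) (\<lambda>g. 0) F"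
    using inner K unfolding approx_inner_def approx_unitarily_equiv_def cocycle_id_def by auto
  have "\<forall>\<^sub>F w in F. \<forall>x\<in>X. dist (Ad w x) (\<theta> x) < \<epsilon>/2"
    using tendstoD[OF F(3), of "\<epsilon>/2"] \<open>0 < \<epsilon>\<close> by (simp add: eventually_ball_finite X)
  moreover have "\<forall>\<^sub>F w in F. \<forall>x\<in>X. \<forall>g\<in>K. dist (\<theta> x \<lhd> (c g - w * star (mult_ext (\<alpha> g) w))) 0 < \<epsilon>/2"
    using uniform_limitD[OF F(4), of "\<epsilon>/2"] \<open>0 < \<epsilon>\<close> by (simp add: eventually_ball_finite X)
  ultimately have "\<forall>\<^sub>F w in F. unitary w \<and> (\<forall>x\<in>X. dist (Ad w x) (\<theta> x) < \<epsilon>/2) \<and>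
      (\<forall>x\<in>X. \<forall>g\<in>K. dist (\<theta> x \<lhd> (c g - w * star (mult_ext (\<alpha> g) w))) 0 < \<epsilon>/2)"
    using F(2) by eventually_elim blast
  from eventually_happens'[OF F(1) this] obtain w where w: "unitary w"
    and near: "\<And>x. x \<in> X \<Longrightarrow> dist (Ad w x) (\<theta> x) < \<epsilon>/2"
      "\<And>x g. x \<in> X \<Longrightarrow> g \<in> K \<Longrightarrow> dist (\<theta> x \<lhd> (c g - w * star (mult_ext (\<alpha> g) w))) 0 < \<epsilon>/2"
    by blast
  show ?thesis
  proof (rule that[OF unitary_star[OF w]])
    fix x g assume xg: "x \<in> X" "g \<in> K"
    define E where "E = mult_ext (\<alpha> g) w"
    have E: "unitary E" unfolding E_def by (rule ext_unitary[OF w])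
    have conj: "bundle_conj \<alpha> (star w) (bundle_map \<theta> c) g x = (star w \<rhd> (\<theta> x \<lhd> c g)) \<lhd> E"
      by (simp only: bundle_conj_def bundle_map_def ext_star[OF w] star_star_multiplier E_def)
    have x: "x = (star w \<rhd> ((w \<rhd> x) \<lhd> star E)) \<lhd> E"
      by (simp only: lmult_rmult unitary_cancel[OF E] unitary_cancel[OF w])
    have Ad: "Ad w x \<lhd> (w * star E) = (w \<rhd> x) \<lhd> star E"
      by (simp only: Ad_def rmult_simps(6) unitary_cancel[OF w])
    have "bundle_conj \<alpha> (star w) (bundle_map \<theta> c) g x - x = (star w \<rhd> (\<theta> x \<lhd> c g - (w \<rhd> x) \<lhd> star E)) \<lhd> E"
      by (subst (2) x) (simp only: conj lmult_diff rmult_diff)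
    then have "dist (bundle_conj \<alpha> (star w) (bundle_map \<theta> c) g x) x = norm (\<theta> x \<lhd> c g - (w \<rhd> x) \<lhd> star E)"
      by (simp only: dist_norm norm_unitary_rmult[OF E] norm_unitary_lmult[OF unitary_star[OF w]])
    also have "\<theta> x \<lhd> c g - (w \<rhd> x) \<lhd> star E = \<theta> x \<lhd> (c g - w * star E) + (\<theta> x - Ad w x) \<lhd> (w * star E)"
      by (simp only: rmult_simps(5) rmult_diff Ad) simp
    also have "norm \<dots> \<le> norm (\<theta> x \<lhd> (c g - w * star E)) + norm (\<theta> x - Ad w x)"
      using norm_triangle_ineq[of "\<theta> x \<lhd> (c g - w * star E)" "(\<theta> x - Ad w x) \<lhd> (w * star E)"]
      by (simp only: norm_unitary_rmult[OF unitary_mult[OF w unitary_star[OF E]]])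
    also have "\<dots> < \<epsilon>"
      using near(1)[OF xg(1)] near(2)[OF xg] by (simp add: dist_norm norm_minus_commute E_def)
    finally show "dist (bundle_conj \<alpha> (star w) (bundle_map \<theta> c) g x) x < \<epsilon>" .
  qed
qed

text \<open>
  Conversely, convergence of the fibre maps gives the first convergence at \<open>g = 0\<close>. For the
  cocycles it gives the convergence only after multiplication by elements \<open>b = \<Phi> a\<close>, which are
  all elements because \<open>\<Phi>\<close> is surjective.
\<close>

lemma (in action_pair) approx_unitarily_equivI:
  assumes X: "cocycle_morphism \<alpha> \<beta> (\<phi>, u)" and "surj \<Phi>" and U: "U 0 = 1"
    and w: "\<And>n. unitary (w n)"
    and lim: "\<And>K a. compact K \<Longrightarrow>
      uniform_limit K (\<lambda>n g. bundle_conj \<beta> (w n) (bundle_map \<phi> u) g a) (\<lambda>g. bundle_map \<Phi> U g a) sequentially"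
  shows "approx_unitarily_equiv \<beta> (\<phi>, u) (\<Phi>, U)"
proof -
  have Ad0: "bundle_conj \<beta> (w n) (bundle_map \<phi> u) 0 a = Ad (w n) (\<phi> a)" for n a
    by (simp add: bundle_conj_def bundle_map_0[OF X] B.ext_zero w Ad_def)
  have Ad_lim: "(\<lambda>n. Ad (w n) (\<phi> a)) \<longlonglongrightarrow> \<Phi> a" for a
    using tendsto_uniform_limitI[OF lim[of "{0}" a]] by (simp add: Ad0) (simp add: bundle_map_def U)
  have "uniform_limit K (\<lambda>n g. b \<lhd> (U g - w n * u g * star (mult_ext (\<beta> g) (w n)))) (\<lambda>g. 0) sequentially"
    if K: "compact K" for b K
  proof -
    obtain a where b: "b = \<Phi> a" using \<open>surj \<Phi>\<close> by (auto simp: surj_def)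
    let ?T = "\<lambda>n g. bundle_conj \<beta> (w n) (bundle_map \<phi> u) g a"
    have bound: "norm (b \<lhd> (U g - w n * u g * star (mult_ext (\<beta> g) (w n)))) \<le>
        dist (?T n g) (bundle_map \<Phi> U g a) + dist (Ad (w n) (\<phi> a)) (\<Phi> a)" for n g
    proof -
      let ?v = "w n * u g * star (mult_ext (\<beta> g) (w n))"
      have v: "unitary ?v"
        by (intro unitary_mult unitary_star w B.ext_unitary cocycle_morphismD(2)[OF X])
      have "?T n g = Ad (w n) (\<phi> a) \<lhd> ?v"
        by (simp only: bundle_conj_def bundle_map_def Ad_def rmult_simps(6) unitary_cancel[OF w] lmult_rmult)
      then have "b \<lhd> (U g - ?v) = (bundle_map \<Phi> U g a - ?T n g) + (Ad (w n) (\<phi> a) - \<Phi> a) \<lhd> ?v"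
        by (simp only: rmult_simps(5) rmult_diff b bundle_map_def) simp
      then show ?thesis
        using norm_triangle_ineq[of "bundle_map \<Phi> U g a - ?T n g" "(Ad (w n) (\<phi> a) - \<Phi> a) \<lhd> ?v"]
        by (simp only: norm_unitary_rmult[OF v] dist_norm norm_minus_commute)
    qed
    show ?thesis
    proof (rule uniform_limitI)
      fix e :: real assume "0 < e"
      have "\<forall>\<^sub>F n in sequentially. \<forall>g\<in>K. dist (?T n g) (bundle_map \<Phi> U g a) < e/2"
        using uniform_limitD[OF lim[OF K, of a], of "e/2"] \<open>0 < e\<close> by simp
      moreover have "\<forall>\<^sub>F n in sequentially. dist (Ad (w n) (\<phi> a)) (\<Phi> a) < e/2"
        using tendstoD[OF Ad_lim, of "e/2"] \<open>0 < e\<close> by simp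
      ultimately show "\<forall>\<^sub>F n in sequentially. \<forall>g\<in>K.
          dist (b \<lhd> (U g - w n * u g * star (mult_ext (\<beta> g) (w n)))) 0 < e"
      proof eventually_elim
        case (elim n)
        show ?case
        proof
          fix g assume "g \<in> K"
          with elim bound[of g n] show "dist (b \<lhd> (U g - w n * u g * star (mult_ext (\<beta> g) (w n)))) 0 < e"
            unfolding dist_norm diff_0_right by fastforce
        qed
      qed
    qed
  qed
  with w Ad_lim show ?thesis
    unfolding approx_unitarily_equiv_def
    by (auto intro!: exI[of _ "filtermap w sequentially"]
        simp: filtermap_bot_iff eventually_filtermap filterlim_filtermap)
qed


section \<open>Two-sided intertwining of cocycle morphisms\<close>

text \<open>
  The intertwining needs an approximate inverse for every map in the orbit of \<open>(\<phi>, u)\<close>, while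
  the hypothesis concerns \<open>(\<phi>, u)\<close> itself. Conjugating \<open>(\<phi>, u)\<close> by \<open>z\<close> conjugates the
  composition by \<open>\<psi>(z)\<close>, which the choice \<open>w \<psi>(z)\<^sup>*\<close> undoes.
\<close>

lemma (in action_pair) bundle_orbit_approx_inverse:
  assumes X: "cocycle_morphism \<alpha> \<beta> (\<phi>, u)"
    and Y: "cocycle_morphism \<beta> \<alpha> (\<psi>, v)" "nondegenerate \<psi>"
    and inner: "approx_inner \<alpha> (cocycle_comp (\<psi>, v) (\<phi>, u))"
    and z: "unitary z" and "finite C" "compact K" "0 < \<epsilon>"
  obtains w where "unitary w" "\<And>x g. x \<in> C \<Longrightarrow> g \<in> K \<Longrightarrow>
    dist (bundle_conj \<alpha> w (bundle_map \<psi> v) g (bundle_conj \<beta> z (bundle_map \<phi> u) g x)) x < \<epsilon>"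
proof -
  interpret BA: action_pair \<beta> \<alpha> ..
  note Psi = BA.cocycle_morphismD(1)[OF Y(1)]
  have comp: "bundle_map (\<psi> \<circ> \<phi>) (\<lambda>g. mult_ext \<psi> (u g) * v g) =
      (\<lambda>g x. bundle_map \<psi> v g (bundle_map \<phi> u g x))"
    by (intro ext bundle_map_comp Psi Y cocycle_morphismD(2)[OF X])
  obtain w where w: "unitary w" "\<And>x g. x \<in> C \<Longrightarrow> g \<in> K \<Longrightarrow>
      dist (bundle_conj \<alpha> w (\<lambda>g x. bundle_map \<psi> v g (bundle_map \<phi> u g x)) g x) x < \<epsilon>"
    using A.approx_inner_bundle_map[OF inner[unfolded cocycle_comp_def prod.case] \<open>finite C\<close> \<open>compact K\<close> \<open>0 < \<epsilon>\<close>]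
    unfolding comp by blast
  let ?z = "mult_ext \<psi> z"
  have z': "unitary ?z" by (rule unitary_mult_ext[OF Psi Y(2) z])
  then have "w * star ?z * ?z = w" by (simp add: unitary_def mult.assoc)
  with w show ?thesis
    by (intro that[of "w * star ?z"] unitary_mult unitary_star z')
      (simp_all add: BA.bundle_conj_bundle_map[OF Y z] unitary_mult unitary_star z')
qed

theorem theoremC:
  fixes \<alpha> :: "'g::{topological_group_add, t2_space, second_countable_topology} \<Rightarrow> 'a::cstar_algebra \<Rightarrow> 'a"
    and \<beta> :: "'g \<Rightarrow> 'b::cstar_algebra \<Rightarrow> 'b"
    and \<phi> :: "'a \<Rightarrow> 'b" and u :: "'g \<Rightarrow> 'b multiplier"
    and \<psi> :: "'b \<Rightarrow> 'a" and v :: "'g \<Rightarrow> 'a multiplier"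
  assumes "locally_compact_space (euclidean :: 'g topology)"
    and "separable_space (euclidean :: 'a topology)"
    and "separable_space (euclidean :: 'b topology)"
    and "cstar_action \<alpha>" and "cstar_action \<beta>"
    and "nondegenerate_cocycle_morphism \<alpha> \<beta> (\<phi>, u)"
    and "nondegenerate_cocycle_morphism \<beta> \<alpha> (\<psi>, v)"
    and "approx_inner \<alpha> (cocycle_comp (\<psi>, v) (\<phi>, u))"
    and "approx_inner \<beta> (cocycle_comp (\<phi>, u) (\<psi>, v))"
  shows "\<exists>X Y. cocycle_conjugacy \<alpha> \<beta> X \<and> cocycle_conjugacy \<beta> \<alpha> Y \<and> Y = cocycle_inverse X \<and>
    approx_unitarily_equiv \<beta> (\<phi>, u) X \<and> approx_unitarily_equiv \<alpha> (\<psi>, v) Y"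
proof -
  have X: "cocycle_morphism \<alpha> \<beta> (\<phi>, u)" and nd_X: "nondegenerate \<phi>"
    and Y: "cocycle_morphism \<beta> \<alpha> (\<psi>, v)" and nd_Y: "nondegenerate \<psi>"
    using assms(6,7) by (auto simp: nondegenerate_cocycle_morphism_def)
  have "nondegenerate (id :: 'a \<Rightarrow> 'a)" "nondegenerate (id :: 'b \<Rightarrow> 'b)"
    by (rule nondegenerate_surj[OF nd_Y], simp) (rule nondegenerate_surj[OF nd_X], simp)
  then interpret action_pair \<alpha> \<beta>
    by unfold_locales (use assms in auto)
  interpret BA: action_pair \<beta> \<alpha> ..
  let ?T = "bundle_map \<phi> u" and ?S = "bundle_map \<psi> v"
  note T = bundle_hom_conj[OF bundle_hom_bundle_map[OF X]]
    and S = BA.bundle_hom_conj[OF BA.bundle_hom_bundle_map[OF Y]]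
  let ?\<F> = "{bundle_conj \<beta> w ?T |w. unitary w}" and ?\<S> = "{bundle_conj \<alpha> w ?S |w. unitary w}"
  obtain f s f' s' where f: "\<And>n. f n \<in> ?\<F>"
      "\<And>K x. compact K \<Longrightarrow> uniform_limit K (\<lambda>n g. f n g x) (\<lambda>g. f' g x) sequentially"
    and s: "\<And>n. s n \<in> ?\<S>"
      "\<And>K x. compact K \<Longrightarrow> uniform_limit K (\<lambda>n g. s n g x) (\<lambda>g. s' g x) sequentially"
    and inv: "\<And>g x. s' g (f' g x) = x" "\<And>g x. f' g (s' g x) = x"
  proof (rule two_sided_approximate_intertwining[OF assms(1-3), of ?\<F> ?\<S>])
    show "dist (h g x) (h g y) \<le> dist x y" "continuous_on UNIV (\<lambda>g. h g x)" if "h \<in> ?\<F>" for h g x y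
      using that by (auto intro: bundle_hom_dist_le[OF T] bundle_homD(6)[OF T])
    show "?\<F> \<noteq> {}" using unitary_one by blast
    show "dist (h g x) (h g y) \<le> dist x y" "continuous_on UNIV (\<lambda>g. h g x)" if "h \<in> ?\<S>" for h g x y
      using that by (auto intro: BA.bundle_hom_dist_le[OF S] BA.bundle_homD(6)[OF S])
    show "\<exists>k\<in>?\<S>. \<forall>x\<in>C. \<forall>g\<in>K. dist (k g (h g x)) x < \<epsilon>"
      if h: "h \<in> ?\<F>" and CK: "finite C" "compact K" "0 < \<epsilon>" for h C K \<epsilon>
    proof -
      obtain z where z: "unitary z" "h = bundle_conj \<beta> z ?T" using h by blast
      obtain k where "unitary k" "\<And>x g. x \<in> C \<Longrightarrow> g \<in> K \<Longrightarrow> dist (bundle_conj \<alpha> k ?S g (h g x)) x < \<epsilon>"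
        using bundle_orbit_approx_inverse[OF X Y nd_Y assms(8) z(1) CK] unfolding z(2) by metis
      then show ?thesis by (intro bexI[of _ "bundle_conj \<alpha> k ?S"]) auto
    qed
    show "\<exists>k\<in>?\<F>. \<forall>x\<in>C. \<forall>g\<in>K. dist (k g (h g x)) x < \<epsilon>"
      if h: "h \<in> ?\<S>" and CK: "finite C" "compact K" "0 < \<epsilon>" for h C K \<epsilon>
    proof -
      obtain z where z: "unitary z" "h = bundle_conj \<alpha> z ?S" using h by blast
      obtain k where "unitary k" "\<And>x g. x \<in> C \<Longrightarrow> g \<in> K \<Longrightarrow> dist (bundle_conj \<beta> k ?T g (h g x)) x < \<epsilon>"
        using BA.bundle_orbit_approx_inverse[OF Y X nd_X assms(9) z(1) CK] unfolding z(2) by metis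
      then show ?thesis by (intro bexI[of _ "bundle_conj \<beta> k ?T"]) auto
    qed
  qed (rule that, assumption+)
  have "\<exists>w. \<forall>n. unitary (w n) \<and> f n = bundle_conj \<beta> (w n) ?T"
    using f(1) by (intro choice) blast
  then obtain w where w: "\<And>n. unitary (w n)" "\<And>n. f n = bundle_conj \<beta> (w n) ?T" by blast
  have "\<exists>z. \<forall>n. unitary (z n) \<and> s n = bundle_conj \<alpha> (z n) ?S"
    using s(1) by (intro choice) blast
  then obtain z where z: "\<And>n. unitary (z n)" "\<And>n. s n = bundle_conj \<alpha> (z n) ?S" by blast
  have f_hom: "bundle_hom \<alpha> \<beta> (f n)" and s_hom: "bundle_hom \<beta> \<alpha> (s n)" for n
    using T[OF w(1)] S[OF z(1)] by (simp_all add: w(2) z(2))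
  have f': "bundle_hom \<alpha> \<beta> f'"
  proof (rule bundle_hom_limit[OF f_hom])
    show "(\<lambda>n. f n g a) \<longlonglongrightarrow> f' g a" for g a
      using tendsto_uniform_limitI[OF f(2)[of "{g}"]] by simp
    show "continuous_on UNIV (\<lambda>g. f' g a)" for a
      by (rule continuous_on_locally_uniform_limit[OF assms(1) _ f(2)]) (rule bundle_homD(6)[OF f_hom])
  qed
  have s': "bundle_hom \<beta> \<alpha> s'"
  proof (rule BA.bundle_hom_limit[OF s_hom])
    show "(\<lambda>n. s n g a) \<longlonglongrightarrow> s' g a" for g a
      using tendsto_uniform_limitI[OF s(2)[of "{g}"]] by simp
    show "continuous_on UNIV (\<lambda>g. s' g a)" for a
      by (rule continuous_on_locally_uniform_limit[OF assms(1) _ s(2)]) (rule BA.bundle_homD(6)[OF s_hom])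
  qed
  obtain U where U: "cocycle_morphism \<alpha> \<beta> (f' 0, U)" "bundle_map (f' 0) U = f'"
    using bundle_iso_cocycle[OF f' s' inv] .
  obtain V where V: "cocycle_morphism \<beta> \<alpha> (s' 0, V)" "bundle_map (s' 0) V = s'"
    using BA.bundle_iso_cocycle[OF s' f' inv(2,1)] .
  have bij: "bij (f' 0)" and inverse: "(s' 0, V) = cocycle_inverse (f' 0, U)"
    using cocycle_inverse_eqI[OF U(1) V(1)] by (simp_all add: U(2) V(2) inv)
  have bij': "bij (s' 0)"
    using BA.cocycle_inverse_eqI(1)[OF V(1) U(1)] by (simp add: U(2) V(2) inv)
  have "approx_unitarily_equiv \<beta> (\<phi>, u) (f' 0, U)"
    by (rule approx_unitarily_equivI[where w = w and U = U, OF X bij_is_surj[OF bij] cocycle_morphismD(5)[OF U(1)] w(1)])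
      (simp only: U(2) w(2)[symmetric] f(2))
  moreover have "approx_unitarily_equiv \<alpha> (\<psi>, v) (s' 0, V)"
    by (rule BA.approx_unitarily_equivI[where w = z and U = V, OF Y bij_is_surj[OF bij'] BA.cocycle_morphismD(5)[OF V(1)] z(1)])
      (simp only: V(2) z(2)[symmetric] s(2))
  moreover have "cocycle_conjugacy \<alpha> \<beta> (f' 0, U)" "cocycle_conjugacy \<beta> \<alpha> (s' 0, V)"
    using U(1) V(1) bij bij' by (simp_all add: cocycle_conjugacy_def)
  ultimately show ?thesis using inverse by blast
qed

end
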